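(* Let $r\ge2$ and $k\ge0$ be integers and let $N = \begin{pmatrix} A' & B \\ J & A'^{\dagger}\end{pmatrix}$ be the $(2r+2)\times(2r+2)$ $0,1$-matrix defined in the context, with rows and columns indexed by $0,1,\ldots,2r+1$. Let $i\in\{r+1,r+2,\ldots,2r+1\}$ and $j\in\{0,1,\ldots,r\}$. Then the $\mathbf{cd}$-index of the interval $[(i,0),(j,k+1)]$ in the level poset associated to $N$ is $$\sum_{w} r^{\text{number of }\mathbf d\text{'s in }w}\cdot w,$$ where $w$ ranges over all $\mathbf{cd}$-monomials of degree $k$.
   Context: Blocks (all $(r+1)\times(r+1)$, indexed by $0\le i,j\le r$): $A'=(a'_{i,j})$ with $a'_{i,j}=1$ if ($i=0$ and $j\le r-1$) or ($i=1$ and $j=r$), and $0$ otherwise; $B=(b_{i,j})$ with $b_{i,j}=1$ if $0\le i-j\le 1$ and $0$ otherwise; $J$ is the all-ones matrix; $A'^{\dagger}$ is the reflection of $A'$ over its anti-diagonal, $(A'^{\dagger})_{i,j}=a'_{r-j,r-i}$. The level poset associated to a $0,1$-matrix $X=(x_{i,j})$ is the ranked poset on (index set) $\times\mathbb{Z}$ with cover relations $(i,s)\prec(j,s+1)$ iff $x_{i,j}=1$. For a graded poset $P$ with rank function $\rho$, minimal element $\hat0$ and maximal element $\hat1$, the $\mathbf{ab}$-index is the polynomial in the non-commutative variables $\mathbf a,\mathbf b$ $$\Psi(P)=\sum_{c}(\mathbf a-\mathbf b)^{\rho(x_0,x_1)-1}\,\mathbf b\,(\mathbf a-\mathbf b)^{\rho(x_1,x_2)-1}\,\mathbf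 b\cdots\mathbf b\,(\mathbf a-\mathbf b)^{\rho(x_m,x_{m+1})-1},$$ the sum being over all chains $c=\{\hat0=x_0<x_1<\cdots<x_m<x_{m+1}=\hat1\}$ ($m\ge0$), where $\rho(x,y)=\rho(y)-\rho(x)$. For Eulerian $P$ it is a polynomial in $\mathbf c=\mathbf a+\mathbf b$ and $\mathbf d=\mathbf a\mathbf b+\mathbf b\mathbf a$, called the $\mathbf{cd}$-index. A $\mathbf{cd}$-monomial is a word in $\mathbf c,\mathbf d$, with $\mathbf c$ of degree $1$ and $\mathbf d$ of degree $2$. *)

theory Defs
  imports
    "HOL-Library.Poly_Mapping"
    "Jordan_Normal_Form.Matrix"
begin

section \<open>Polynomials in non-commuting variables\<close>

text \<open>The free monoid on \<open>'v\<close>, written additively because the convolution product of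
  \<^type>\<open>poly_mapping\<close> adds exponents; the sum of two words is their concatenation, and
  \<open>'v word \<Rightarrow>\<^sub>0 int\<close> becomes the free associative ring on \<open>'v\<close>.\<close>

datatype 'v word = Word (letters: "'v list")

instantiation word :: (type) monoid_add
begin

definition zero_word :: "'a word" where
  "0 = Word []"

definition plus_word :: "'a word \<Rightarrow> 'a word \<Rightarrow> 'a word" where
  "u + v = Word (letters u @ letters v)"

instance
  by standard (simp_all add: zero_word_def plus_word_def)

end

type_synonym 'v ncpoly = "'v word \<Rightarrow>\<^sub>0 int"

definition ncvar :: "'v \<Rightarrow> 'v ncpoly" where
  "ncvar v = Poly_Mapping.single (Word [v]) 1"

definition ncsubst :: "('v \<Rightarrow> 'r::ring_1) \<Rightarrow> 'v ncpoly \<Rightarrow> 'r" where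
  "ncsubst f p =
     (\<Sum>w\<in>Poly_Mapping.keys p. of_int (Poly_Mapping.lookup p w) * prod_list (map f (letters w)))"

datatype ab = Var_a | Var_b

datatype cd = Var_c | Var_d

abbreviation ab_a :: "ab ncpoly" where "ab_a \<equiv> ncvar Var_a"
abbreviation ab_b :: "ab ncpoly" where "ab_b \<equiv> ncvar Var_b"

fun cd_value :: "cd \<Rightarrow> ab ncpoly" where
  "cd_value Var_c = ab_a + ab_b"
| "cd_value Var_d = ab_a * ab_b + ab_b * ab_a"

definition cd_to_ab :: "cd ncpoly \<Rightarrow> ab ncpoly" where
  "cd_to_ab = ncsubst cd_value"

fun cd_letter_degree :: "cd \<Rightarrow> nat" where
  "cd_letter_degree Var_c = 1"
| "cd_letter_degree Var_d = 2"

definition cd_degree :: "cd word \<Rightarrow> nat" where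
  "cd_degree w = sum_list (map cd_letter_degree (letters w))"

definition num_d :: "cd word \<Rightarrow> nat" where
  "num_d w = count_list (letters w) Var_d"

lemma finite_cd_words: "finite {w. cd_degree w = k}"
proof -
  have len: "length xs \<le> sum_list (map cd_letter_degree xs)" for xs
  proof (induction xs)
    case (Cons x xs)
    then show ?case by (cases x) auto
  qed simp
  have fin: "finite {xs :: cd list. set xs \<subseteq> {Var_c, Var_d} \<and> length xs \<le> k}"
    by (rule finite_lists_length_le) simp
  have "{w. cd_degree w = k} \<subseteq> Word ` {xs. set xs \<subseteq> {Var_c, Var_d} \<and> length xs \<le> k}"
  proof
    fix w assume "w \<in> {w. cd_degree w = k}"
    then have "length (letters w) \<le> k"
      using len[of "letters w"] by (simp add: cd_degree_def)
    moreover have "set (letters w) \<subseteq> {Var_c, Var_d}"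
      using cd.exhaust by blast
    ultimately have "letters w \<in> {xs. set xs \<subseteq> {Var_c, Var_d} \<and> length xs \<le> k}"
      by simp
    then show "w \<in> Word ` {xs. set xs \<subseteq> {Var_c, Var_d} \<and> length xs \<le> k}"
      by (metis imageI word.collapse)
  qed
  then show ?thesis
    using fin by (blast intro: finite_subset)
qed


section \<open>Graded posets, ab-index and cd-index\<close>

text \<open>A poset is given by its reflexive order relation \<open>P\<close>; its ground set is
  \<^term>\<open>Field P\<close>.\<close>

definition is_least :: "'a rel \<Rightarrow> 'a \<Rightarrow> bool" where
  "is_least P x \<longleftrightarrow> x \<in> Field P \<and> (\<forall>y\<in>Field P. (x, y) \<in> P)"

definition is_greatest :: "'a rel \<Rightarrow> 'a \<Rightarrow> bool" where
  "is_greatest P x \<longleftrightarrow> x \<in> Field P \<and> (\<forall>y\<in>Field P. (y, x) \<in> P)"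

definition covers :: "'a rel \<Rightarrow> 'a \<Rightarrow> 'a \<Rightarrow> bool" where
  "covers P x y \<longleftrightarrow>
     (x, y) \<in> P \<and> x \<noteq> y \<and> (\<forall>z. (x, z) \<in> P \<and> (z, y) \<in> P \<longrightarrow> z = x \<or> z = y)"

definition poset_interval :: "'a rel \<Rightarrow> 'a \<Rightarrow> 'a \<Rightarrow> 'a rel" where
  "poset_interval P x y = Restr P {z. (x, z) \<in> P \<and> (z, y) \<in> P}"

definition graded_poset :: "'a rel \<Rightarrow> ('a \<Rightarrow> nat) \<Rightarrow> bool" where
  "graded_poset P \<rho> \<longleftrightarrow>
     finite (Field P) \<and> Partial_order P \<and>
     (\<exists>x. is_least P x \<and> \<rho> x = 0) \<and> (\<exists>y. is_greatest P y) \<and>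
     (\<forall>x y. covers P x y \<longrightarrow> \<rho> y = \<rho> x + 1)"

definition eulerian_poset :: "'a rel \<Rightarrow> ('a \<Rightarrow> nat) \<Rightarrow> bool" where
  "eulerian_poset P \<rho> \<longleftrightarrow>
     graded_poset P \<rho> \<and>
     (\<forall>x y. (x, y) \<in> P \<and> x \<noteq> y \<longrightarrow>
        card {z. (x, z) \<in> P \<and> (z, y) \<in> P \<and> even (\<rho> z)} =
        card {z. (x, z) \<in> P \<and> (z, y) \<in> P \<and> odd (\<rho> z)})"

text \<open>A chain \<open>x\<^sub>0 < x\<^sub>1 < \<dots> < x\<^sub>m\<^sub>+\<^sub>1\<close> from the least to the greatest element is
  encoded as the list of its elements.\<close>

definition bounded_chains :: "'a rel \<Rightarrow> 'a list set" where
  "bounded_chains P =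
     {xs. length xs \<ge> 2 \<and> sorted_wrt (\<lambda>x y. (x, y) \<in> P \<and> x \<noteq> y) xs \<and>
          is_least P (hd xs) \<and> is_greatest P (last xs)}"

text \<open>The equations for lists with fewer than two elements are irrelevant.\<close>

fun chain_weight :: "('a \<Rightarrow> nat) \<Rightarrow> 'a list \<Rightarrow> ab ncpoly" where
  "chain_weight \<rho> [] = 1"
| "chain_weight \<rho> [x] = 1"
| "chain_weight \<rho> [x, y] = (ab_a - ab_b) ^ (\<rho> y - \<rho> x - 1)"
| "chain_weight \<rho> (x # y # z # xs) =
     (ab_a - ab_b) ^ (\<rho> y - \<rho> x - 1) * ab_b * chain_weight \<rho> (y # z # xs)"

definition ab_index :: "'a rel \<Rightarrow> ('a \<Rightarrow> nat) \<Rightarrow> ab ncpoly" where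
  "ab_index P \<rho> = (\<Sum>xs\<in>bounded_chains P. chain_weight \<rho> xs)"

text \<open>\<open>P\<close> is Eulerian and \<open>\<Phi>\<close> is its cd-index. The rank function is quantified
  existentially since it is determined by \<open>P\<close> on \<^term>\<open>Field P\<close>.\<close>

definition has_cd_index :: "'a rel \<Rightarrow> cd ncpoly \<Rightarrow> bool" where
  "has_cd_index P \<Phi> \<longleftrightarrow> (\<exists>\<rho>. eulerian_poset P \<rho> \<and> ab_index P \<rho> = cd_to_ab \<Phi>)"


section \<open>Level posets\<close>

definition level_covers :: "int mat \<Rightarrow> (nat \<times> int) rel" where
  "level_covers X =
     {((i, s), (j, s + 1)) | i j s. i < dim_row X \<and> j < dim_col X \<and> X $$ (i, j) = 1}"

text \<open>Meant for square matrices, whose common row and column index set is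
  \<open>{..<dim_row X}\<close>.\<close>

definition level_poset :: "int mat \<Rightarrow> (nat \<times> int) rel" where
  "level_poset X = Restr ((level_covers X)\<^sup>*) ({..<dim_row X} \<times> UNIV)"

lemma level_covers_rtrancl:
  assumes "(p, q) \<in> (level_covers X)\<^sup>*"
  shows "p = q \<or> snd p < snd q"
  using assms by (induction rule: rtrancl_induct) (auto simp: level_covers_def)

lemma Field_level_poset: "Field (level_poset X) = {..<dim_row X} \<times> UNIV"
  by (auto simp: level_poset_def Field_def)

lemma Partial_order_level_poset: "Partial_order (level_poset X)"
proof -
  have "antisym (level_poset X)"
    by (intro antisymI) (auto simp: level_poset_def dest!: level_covers_rtrancl)
  moreover have "trans (level_poset X)"
    by (intro transI) (auto simp: level_poset_def)
  ultimately show ?thesis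
    unfolding Field_level_poset
    by (auto simp: partial_order_on_def preorder_on_def refl_on_def level_poset_def)
qed

lemma covers_level_poset:
  assumes "square_mat X"
  shows "covers (level_poset X) p q \<longleftrightarrow> (p, q) \<in> level_covers X"
proof
  assume c: "covers (level_poset X) p q"
  then have "(p, q) \<in> (level_covers X)\<^sup>*" "p \<noteq> q"
    and q: "q \<in> {..<dim_row X} \<times> UNIV" and p: "p \<in> {..<dim_row X} \<times> UNIV"
    by (auto simp: covers_def level_poset_def)
  then obtain z where z: "(p, z) \<in> level_covers X" "(z, q) \<in> (level_covers X)\<^sup>*"
    by (meson converse_rtranclE)
  then have "z \<in> {..<dim_row X} \<times> UNIV" "z \<noteq> p"
    using assms by (auto simp: level_covers_def)
  then have "z = q"
    using c z p q unfolding covers_def level_poset_def by blast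
  then show "(p, q) \<in> level_covers X" using z by simp
next
  assume pq: "(p, q) \<in> level_covers X"
  then have s: "snd q = snd p + 1"
    and f: "p \<in> {..<dim_row X} \<times> UNIV" "q \<in> {..<dim_row X} \<times> UNIV"
    using assms by (auto simp: level_covers_def)
  have "z = p \<or> z = q" if "(p, z) \<in> level_poset X" "(z, q) \<in> level_poset X" for z
  proof -
    have "p = z \<or> snd p < snd z" "z = q \<or> snd z < snd q"
      using that by (auto simp: level_poset_def dest: level_covers_rtrancl)
    then show ?thesis using s by auto
  qed
  then show "covers (level_poset X) p q"
    using pq s f unfolding covers_def level_poset_def by auto
qed


section \<open>The matrix\<close>

definition block_A' :: "nat \<Rightarrow> int mat" where
  "block_A' r = mat (r + 1) (r + 1)
     (\<lambda>(i, j). if (i = 0 \<and> j \<le> r - 1) \<or> (i = 1 \<and> j = r) then 1 else 0)"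

text \<open>The condition \<open>0 \<le> i - j \<le> 1\<close> without truncated subtraction.\<close>

definition block_B :: "nat \<Rightarrow> int mat" where
  "block_B r = mat (r + 1) (r + 1) (\<lambda>(i, j). if j \<le> i \<and> i \<le> j + 1 then 1 else 0)"

definition block_J :: "nat \<Rightarrow> int mat" where
  "block_J r = mat (r + 1) (r + 1) (\<lambda>_. 1)"

definition block_A'_dagger :: "nat \<Rightarrow> int mat" where
  "block_A'_dagger r = mat (r + 1) (r + 1) (\<lambda>(i, j). block_A' r $$ (r - j, r - i))"

definition matrix_N :: "nat \<Rightarrow> int mat" where
  "matrix_N r = four_block_mat (block_A' r) (block_B r) (block_J r) (block_A'_dagger r)"

end

theory Submission
  imports Defs
begin

text \<open>Any two vertices of the digraph of \<open>N\<close> are joined by walks of every length \<open>\<ge> 3\<close>, and two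
  vertices joined by a walk of length 2 are joined by exactly two. Together with a count of the
  vertices reached in one and in two steps, this makes every interval of the level poset Eulerian.

  For the cd-index, sort the chains by their second element. Let \<open>a\<^sub>n\<close> be the ab-index of an interval
  of length \<open>n\<close> from a vertex above \<open>r\<close> to a fixed vertex \<open>j \<le> r\<close>. From a vertex \<open>t\<close> with
  \<open>2 \<le> t \<le> r\<close> the interval is a suspension, with ab-index \<open>c a\<^sub>n\<^sub>-\<^sub>1\<close>, while those from \<open>0\<close> and \<open>1\<close> enter
  only through their sum, and the ab-indices from \<open>0, \<dots>, r\<close> add up to \<open>a\<^sub>n + r c a\<^sub>n\<^sub>-\<^sub>1\<close>. This yields
  \<open>a\<^sub>n\<^sub>+\<^sub>2 = c a\<^sub>n\<^sub>+\<^sub>1 + r d a\<^sub>n\<close>, the recursion obtained from the weighted sum over cd-words by splitting off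
  the first letter.\<close>


section \<open>Walks in the digraph of the matrix\<close>

definition mat_rel :: "int mat \<Rightarrow> nat rel" where
  "mat_rel X = {(i, j). i < dim_row X \<and> j < dim_col X \<and> X $$ (i, j) = 1}"

lemma level_covers_relpow:
  "((x, s), (y, t)) \<in> level_covers X ^^ n \<longleftrightarrow> t = s + int n \<and> (x, y) \<in> mat_rel X ^^ n"
proof (induction n arbitrary: y t)
  case (Suc n)
  have "((x, s), (y, t)) \<in> level_covers X ^^ Suc n \<longleftrightarrow>
      (\<exists>w u. ((x, s), (w, u)) \<in> level_covers X ^^ n \<and> ((w, u), (y, t)) \<in> level_covers X)"
    by auto
  also have "\<dots> \<longleftrightarrow> t = s + int (Suc n) \<and> (x, y) \<in> mat_rel X ^^ Suc n"
    unfolding Suc by (auto simp: level_covers_def mat_rel_def)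
  finally show ?case .
qed auto

text \<open>Each cover climbs exactly one level, so the levels of two elements prescribe the length
  of every walk between them, and the reflexive transitive closure reduces to a single relational
  power.\<close>

lemma level_poset_iff:
  "((x, s), (y, t)) \<in> level_poset X \<longleftrightarrow>
     x < dim_row X \<and> y < dim_row X \<and> s \<le> t \<and> (x, y) \<in> mat_rel X ^^ nat (t - s)"
proof -
  have "((x, s), (y, t)) \<in> (level_covers X)\<^sup>* \<longleftrightarrow> s \<le> t \<and> (x, y) \<in> mat_rel X ^^ nat (t - s)"
  proof
    assume "((x, s), (y, t)) \<in> (level_covers X)\<^sup>*"
    then obtain n where "((x, s), (y, t)) \<in> level_covers X ^^ n"
      by (auto dest: rtrancl_imp_relpow)
    then show "s \<le> t \<and> (x, y) \<in> mat_rel X ^^ nat (t - s)"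
      by (auto simp: level_covers_relpow)
  next
    assume "s \<le> t \<and> (x, y) \<in> mat_rel X ^^ nat (t - s)"
    then have "((x, s), (y, t)) \<in> level_covers X ^^ nat (t - s)"
      by (simp add: level_covers_relpow)
    then show "((x, s), (y, t)) \<in> (level_covers X)\<^sup>*"
      by (rule relpow_imp_rtrancl)
  qed
  then show ?thesis by (auto simp: level_poset_def)
qed

section \<open>Walks of length one, two and at least three\<close>

abbreviation N_rel :: "nat \<Rightarrow> nat rel" where
  "N_rel r \<equiv> mat_rel (matrix_N r)"

lemma dim_matrix_N [simp]: "dim_row (matrix_N r) = 2 * r + 2" "dim_col (matrix_N r) = 2 * r + 2"
  by (simp_all add: matrix_N_def block_A'_def block_A'_dagger_def)

text \<open>The columns carrying a 1 in row \<open>x\<close> of \<^term>\<open>matrix_N r\<close>. Indices up to \<open>r\<close> belong to the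
  blocks \<open>A'\<close> and \<open>B\<close>, larger ones to \<open>J\<close> and the reflection of \<open>A'\<close>; \<open>succs2\<close> collects the endpoints of the walks of
  length two.\<close>

definition succs :: "nat \<Rightarrow> nat \<Rightarrow> nat set" where
  "succs r x =
     (if x = 0 then {..<r} \<union> {r + 1}
      else if x = 1 then {r, r + 1, r + 2}
      else if x \<le> r then {r + x, r + x + 1}
      else if x = r + 1 then {..r} \<union> {2 * r}
      else {..r} \<union> {2 * r + 1})"

definition succs2 :: "nat \<Rightarrow> nat \<Rightarrow> nat set" where
  "succs2 r x =
     (if x = 0 then {..2 * r}
      else if x = 1 then {..r} \<union> {2 * r, 2 * r + 1}
      else if x \<le> r then {..r} \<union> {2 * r + 1}
      else {..2 * r + 1})"

lemma N_rel_iff: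
  assumes "r \<ge> 2"
  shows "(x, y) \<in> N_rel r \<longleftrightarrow> x < 2 * r + 2 \<and> y \<in> succs r x"
proof -
  have d: "dim_row (block_A' r) = r + 1" "dim_col (block_A' r) = r + 1"
    "dim_row (block_A'_dagger r) = r + 1" "dim_col (block_A'_dagger r) = r + 1"
    by (simp_all add: block_A'_def block_A'_dagger_def)
  consider "\<not> x < 2 * r + 2" | "x < 2 * r + 2" "\<not> y < 2 * r + 2"
    | "x \<le> r" "y \<le> r" | "x \<le> r" "r < y" "y < 2 * r + 2"
    | "r < x" "x < 2 * r + 2" "y \<le> r" | "r < x" "x < 2 * r + 2" "r < y" "y < 2 * r + 2"
    by linarith
  then show ?thesis
  proof cases
    case 1 then show ?thesis by (simp add: mat_rel_def)
  next
    case 2 then show ?thesis using assms by (auto simp: mat_rel_def succs_def)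
  next
    case 3 then show ?thesis using assms
      by (auto simp: mat_rel_def succs_def matrix_N_def d block_A'_def)
  next
    case 4
    then have "matrix_N r $$ (x, y) = 1 \<longleftrightarrow> y = r + x \<or> y = r + x + 1"
      using assms by (simp add: matrix_N_def d block_B_def) arith
    then show ?thesis using assms 4
      by (auto simp: mat_rel_def succs_def)
  next
    case 5 then show ?thesis using assms
      by (auto simp: mat_rel_def succs_def matrix_N_def d block_J_def)
  next
    case 6
    \<comment> \<open>The reflection looks up row \<open>2 * r + 1 - y\<close> of \<open>A'\<close>:
      row 0 belongs to \<open>y = 2 * r + 1\<close>, row 1 to \<open>y = 2 * r\<close>, and all
      other rows vanish.\<close>
    then have "matrix_N r $$ (x, y) = block_A' r $$ (r - (y - (r + 1)), r - (x - (r + 1)))"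
      by (simp add: matrix_N_def d block_A'_dagger_def)
    also have "\<dots> = 1 \<longleftrightarrow> y = 2 * r + 1 \<and> x > r + 1 \<or> y = 2 * r \<and> x = r + 1"
      using 6 assms by (auto simp: block_A'_def)
    finally show ?thesis using assms 6
      by (auto simp: mat_rel_def succs_def)
  qed
qed

lemma succs_less:
  "r \<ge> 2 \<Longrightarrow> x < 2 * r + 2 \<Longrightarrow> y \<in> succs r x \<Longrightarrow> y < 2 * r + 2"
  by (auto simp: succs_def split: if_splits)

lemma finite_succs [simp]: "finite (succs r x)"
  by (simp add: succs_def)

lemma finite_succs2 [simp]: "finite (succs2 r x)"
  by (simp add: succs2_def)

lemma succs2_less: "r \<ge> 2 \<Longrightarrow> y \<in> succs2 r x \<Longrightarrow> y < 2 * r + 2"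
  by (auto simp: succs2_def split: if_splits)

text \<open>Equivalently, the square of the matrix has only the entries 0 and 2, which is the
  Eulerian condition for intervals of length two. Each case names both midpoints.\<close>

lemma card_two_step_walks:
  assumes "r \<ge> 2" "x < 2 * r + 2"
  shows "card {u \<in> succs r x. y \<in> succs r u} = (if y \<in> succs2 r x then 2 else 0)"
proof (cases "y \<in> succs2 r x")
  case True
  then have y: "y < 2 * r + 2" using assms succs2_less by blast
  have "\<exists>u v. u \<noteq> v \<and> {u \<in> succs r x. y \<in> succs r u} = {u, v}"
  proof -
    consider "x = 0" "y < r" | "x = 0" "y = r" | "x = 0" "r < y" "y < 2 * r" | "x = 0" "y = 2 * r"
      | "x = 1" "y < r" | "x = 1" "y = r" | "x = 1" "y = 2 * r" | "x = 1" "y = 2 * r + 1"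
      | "2 \<le> x" "x \<le> r" "y \<le> r" | "2 \<le> x" "x \<le> r" "y = 2 * r + 1"
      | "r < x" "y < r" | "r < x" "y = r"
      | "r < x" "r < y" "y < 2 * r + 1" | "r < x" "y = 2 * r + 1"
      using True assms by (force simp: succs2_def split: if_splits)
    then show ?thesis
    proof cases
      case 1 show ?thesis
        by (rule exI[of _ 0], rule exI[of _ "r + 1"])
          (use 1 assms in \<open>auto simp: succs_def split: if_splits\<close>)
    next
      case 2 show ?thesis
        by (rule exI[of _ 1], rule exI[of _ "r + 1"])
          (use 2 assms in \<open>auto simp: succs_def split: if_splits\<close>)
    next
      \<comment> \<open>Column \<open>y - (r + 1)\<close> of \<open>B\<close> has its ones in the
        rows \<open>y - (r + 1)\<close> and \<open>y - r\<close>.\<close>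
      case 3 show ?thesis
        by (rule exI[of _ "y - (r + 1)"], rule exI[of _ "y - r"])
          (use 3 assms in \<open>auto simp: succs_def split: if_splits\<close>)
    next
      case 4 show ?thesis
        by (rule exI[of _ "r - 1"], rule exI[of _ "r + 1"])
          (use 4 assms in \<open>auto simp: succs_def split: if_splits\<close>)
    next
      case 5 show ?thesis
        by (rule exI[of _ "r + 1"], rule exI[of _ "r + 2"])
          (use 5 assms in \<open>auto simp: succs_def split: if_splits\<close>)
    next
      case 6 show ?thesis
        by (rule exI[of _ "r + 1"], rule exI[of _ "r + 2"])
          (use 6 assms in \<open>auto simp: succs_def split: if_splits\<close>)
    next
      case 7 show ?thesis
        by (rule exI[of _ "r"], rule exI[of _ "r + 1"])
          (use 7 assms in \<open>auto simp: succs_def split: if_splits\<close>)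
    next
      case 8 show ?thesis
        by (rule exI[of _ "r"], rule exI[of _ "r + 2"])
          (use 8 assms in \<open>auto simp: succs_def split: if_splits\<close>)
    next
      case 9 show ?thesis
        by (rule exI[of _ "r + x"], rule exI[of _ "r + x + 1"])
          (use 9 assms in \<open>auto simp: succs_def split: if_splits\<close>)
    next
      case 10 show ?thesis
        by (rule exI[of _ "r + x"], rule exI[of _ "r + x + 1"])
          (use 10 assms in \<open>auto simp: succs_def split: if_splits\<close>)
    next
      \<comment> \<open>The second midpoint is the only successor of \<open>x\<close> above
        \<open>r\<close>; through \<open>J\<close> it reaches every
        \<open>y \<le> r\<close>.\<close>
      case 11 show ?thesis
        by (rule exI[of _ 0], rule exI[of _ "if x = r + 1 then 2 * r else 2 * r + 1"])
          (use 11 assms in \<open>auto simp: succs_def split: if_splits\<close>)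
    next
      case 12 show ?thesis
        by (rule exI[of _ 1], rule exI[of _ "if x = r + 1 then 2 * r else 2 * r + 1"])
          (use 12 assms in \<open>auto simp: succs_def split: if_splits\<close>)
    next
      case 13 show ?thesis
        by (rule exI[of _ "y - (r + 1)"], rule exI[of _ "y - r"])
          (use 13 assms in \<open>auto simp: succs_def split: if_splits\<close>)
    next
      case 14 show ?thesis
        by (rule exI[of _ r], rule exI[of _ "if x = r + 1 then 2 * r else 2 * r + 1"])
          (use 14 assms in \<open>auto simp: succs_def split: if_splits\<close>)
    qed
  qed
  then show ?thesis using True by auto
next
  case False
  then have none: "{u \<in> succs r x. y \<in> succs r u} = {}"
    using assms by (auto simp: succs2_def succs_def split: if_splits)
  show ?thesis using False by (simp only: none) simp
qed

lemma N_rel_relpow_2: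
  assumes "r \<ge> 2"
  shows "(x, y) \<in> N_rel r ^^ 2 \<longleftrightarrow> x < 2 * r + 2 \<and> y \<in> succs2 r x"
proof -
  have "(x, y) \<in> N_rel r ^^ 2 \<longleftrightarrow> x < 2 * r + 2 \<and> {u \<in> succs r x. y \<in> succs r u} \<noteq> {}"
    using succs_less[OF assms] by (auto simp: numeral_2_eq_2 N_rel_iff[OF assms])
  also have "\<dots> \<longleftrightarrow> x < 2 * r + 2 \<and> y \<in> succs2 r x"
  proof (rule conj_cong[OF refl])
    assume "x < 2 * r + 2"
    moreover have "finite {u \<in> succs r x. y \<in> succs r u}" by simp
    ultimately show "{u \<in> succs r x. y \<in> succs r u} \<noteq> {} \<longleftrightarrow> y \<in> succs2 r x"
      using card_two_step_walks[OF assms, of x y] by (metis card_eq_0_iff zero_neq_numeral)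
  qed
  finally show ?thesis .
qed

text \<open>Two steps from any vertex reach all of \<open>{..r}\<close> and some vertex above
  \<open>r\<close>. The latter leads through \<open>J\<close> to every \<open>y \<le> r\<close>, the
  former through the diagonal of \<open>B\<close> to every \<open>y > r\<close>.\<close>

lemma N_rel_relpow_ge_3:
  assumes "r \<ge> 2"
  shows "(x, y) \<in> N_rel r ^^ (n + 3) \<longleftrightarrow> x < 2 * r + 2 \<and> y < 2 * r + 2"
proof (induction n arbitrary: y)
  case 0
  have "(x, y) \<in> N_rel r ^^ 3 \<longleftrightarrow> (\<exists>u. (x, u) \<in> N_rel r ^^ 2 \<and> (u, y) \<in> N_rel r)"
    by (auto simp: numeral_3_eq_3 numeral_2_eq_2)
  also have "\<dots> \<longleftrightarrow> x < 2 * r + 2 \<and> (\<exists>u. u \<in> succs2 r x \<and> y \<in> succs r u)"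
    using succs2_less[OF assms] by (auto simp: N_rel_iff[OF assms] N_rel_relpow_2[OF assms])
  also have "\<dots> \<longleftrightarrow> x < 2 * r + 2 \<and> y < 2 * r + 2"
  proof (intro conj_cong refl iffI)
    assume "\<exists>u. u \<in> succs2 r x \<and> y \<in> succs r u"
    then show "y < 2 * r + 2" using succs2_less[OF assms] succs_less[OF assms] by blast
  next
    assume x: "x < 2 * r + 2" and y: "y < 2 * r + 2"
    show "\<exists>u. u \<in> succs2 r x \<and> y \<in> succs r u"
    proof (cases "y \<le> r")
      case True
      then show ?thesis
        by (intro exI[of _ "if x = 0 then 2 * r else 2 * r + 1"]) (use x assms in \<open>auto simp: succs2_def succs_def\<close>)
    next
      case False
      then show ?thesis
        by (intro exI[of _ "y - (r + 1)"]) (use x y assms in \<open>auto simp: succs2_def succs_def\<close>)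
    qed
  qed
  finally show ?case by simp
next
  case (Suc n)
  have "(x, y) \<in> N_rel r ^^ (Suc n + 3) \<longleftrightarrow> (\<exists>u. (x, u) \<in> N_rel r ^^ (n + 3) \<and> (u, y) \<in> N_rel r)"
    by (simp only: add_Suc relpow.simps) blast
  also have "\<dots> \<longleftrightarrow> x < 2 * r + 2 \<and> (\<exists>u < 2 * r + 2. y \<in> succs r u)"
    unfolding Suc N_rel_iff[OF assms] by auto
  also have "\<dots> \<longleftrightarrow> x < 2 * r + 2 \<and> y < 2 * r + 2"
  proof (intro conj_cong refl iffI)
    assume y: "y < 2 * r + 2"
    show "\<exists>u < 2 * r + 2. y \<in> succs r u"
      by (intro exI[of _ "if y \<le> r then r + 2 else y - (r + 1)"]) (use y assms in \<open>auto simp: succs_def\<close>)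
  qed (use succs_less[OF assms] in auto)
  finally show ?case .
qed

section \<open>Anti-diagonal symmetry and numbers of successors and predecessors\<close>

text \<open>Reflection over the anti-diagonal exchanges the two diagonal blocks and fixes
  \<open>B\<close> and \<open>J\<close>, so the map from \<open>x\<close> to
  \<open>2 * r + 1 - x\<close> reverses all edges.\<close>

lemma succs_rev:
  assumes "r \<ge> 2" "x < 2 * r + 2" "y < 2 * r + 2"
  shows "x \<in> succs r y \<longleftrightarrow> 2 * r + 1 - y \<in> succs r (2 * r + 1 - x)"
proof -
  consider "y = 0" | "y = 1" | "2 \<le> y" "y \<le> r" | "y = r + 1" | "r + 2 \<le> y"
    by linarith
  then show ?thesis
  proof cases
    case 1 then show ?thesis using assms by (auto simp: succs_def)
  next
    case 2 then show ?thesis using assms by (simp add: succs_def) arith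
  next
    case 3 then show ?thesis using assms by (simp add: succs_def) arith
  next
    case 4 then show ?thesis using assms by (simp add: succs_def) arith
  next
    case 5 then show ?thesis using assms by (simp add: succs_def) arith
  qed
qed

lemma succs2_rev:
  assumes "r \<ge> 2" "x < 2 * r + 2" "y < 2 * r + 2"
  shows "x \<in> succs2 r y \<longleftrightarrow> 2 * r + 1 - y \<in> succs2 r (2 * r + 1 - x)"
proof -
  consider "y = 0" | "y = 1" | "2 \<le> y" "y \<le> r" | "r + 1 \<le> y"
    by linarith
  then show ?thesis
  proof cases
    case 1 then show ?thesis using assms by (auto simp: succs2_def)
  next
    case 2 then show ?thesis using assms by (simp add: succs2_def) arith
  next
    case 3 then show ?thesis using assms by (simp add: succs2_def) arith
  next
    case 4 then show ?thesis using assms by (simp add: succs2_def) arith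
  qed
qed

text \<open>The sizes \<open>r + 1\<close>, 3, 2, \<open>r + 2\<close> of the four kinds of
  successor sets become \<open>2 * r + 1\<close>, \<open>r + 3\<close>, \<open>r + 2\<close>,
  \<open>2 * r + 2\<close>. That the excess is the same everywhere makes the dependence on
  \<open>x\<close> cancel in the alternating sums.\<close>

lemma card_succs2:
  assumes "r \<ge> 2" "x < 2 * r + 2"
  shows "card (succs2 r x) = card (succs r x) + r"
proof -
  have *: "card ({..r} \<union> {u}) = r + 2" if "r < u" for u
    using that by (subst card_Un_disjoint) auto
  have **: "card ({..r} \<union> {2 * r, 2 * r + 1}) = r + 3"
    using assms by (subst card_Un_disjoint) auto
  have ***: "card ({..<r} \<union> {r + 1}) = r + 1"
    by (subst card_Un_disjoint) auto
  show ?thesis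
    using assms unfolding succs2_def succs_def
    by (simp only: * ** *** split: if_splits) (auto simp: * ** ***)
qed

text \<open>The bound on \<open>u\<close> is explicit because \<open>succs\<close> assigns the value
  of its last branch to indices beyond the matrix.\<close>

definition preds :: "nat \<Rightarrow> nat \<Rightarrow> nat set" where
  "preds r y = {u. u < 2 * r + 2 \<and> y \<in> succs r u}"

definition preds2 :: "nat \<Rightarrow> nat \<Rightarrow> nat set" where
  "preds2 r y = {u. u < 2 * r + 2 \<and> y \<in> succs2 r u}"

text \<open>Predecessors of \<open>y\<close> are the reflections of the successors of the reflected
  vertex, so the count carries over from \<open>card_succs2\<close>.\<close>

lemma card_preds2:
  assumes "r \<ge> 2" "y < 2 * r + 2"
  shows "card (preds2 r y) = card (preds r y) + r"
proof -
  let ?f = "\<lambda>u. 2 * r + 1 - u"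
  \<comment> \<open>Below \<open>2 * r + 2\<close> the subtraction is exact and \<open>?f\<close> is
    an involution.\<close>
  have rev: "u \<in> ?f ` A \<longleftrightarrow> ?f u \<in> A" if "u < 2 * r + 2" "A \<subseteq> {..<2 * r + 2}" for u A
    using that by (auto simp: image_iff intro!: bexI[of _ "?f u"])
  have inj: "inj_on ?f A" if "A \<subseteq> {..<2 * r + 2}" for A
  proof (rule inj_onI)
    fix u v assume "u \<in> A" "v \<in> A" "?f u = ?f v"
    moreover from this have "u < 2 * r + 2" "v < 2 * r + 2" using that by auto
    ultimately show "u = v" by arith
  qed
  have y: "?f y < 2 * r + 2" using assms by auto
  have s: "succs r (?f y) \<subseteq> {..<2 * r + 2}" "succs2 r (?f y) \<subseteq> {..<2 * r + 2}"
    using succs_less[OF assms(1) y] succs2_less[OF assms(1)] by auto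
  have "preds r y = ?f ` succs r (?f y)"
  proof (intro Set.set_eqI)
    fix u
    show "u \<in> preds r y \<longleftrightarrow> u \<in> ?f ` succs r (?f y)"
    proof (cases "u < 2 * r + 2")
      case True
      then show ?thesis
        using rev[OF True s(1)] succs_rev[OF assms(1) assms(2) True] by (simp add: preds_def)
    qed (auto simp: preds_def)
  qed
  moreover have "preds2 r y = ?f ` succs2 r (?f y)"
  proof (intro Set.set_eqI)
    fix u
    show "u \<in> preds2 r y \<longleftrightarrow> u \<in> ?f ` succs2 r (?f y)"
    proof (cases "u < 2 * r + 2")
      case True
      then show ?thesis
        using rev[OF True s(2)] succs2_rev[OF assms(1) assms(2) True] by (simp add: preds2_def)
    qed (auto simp: preds2_def)
  qed
  ultimately show ?thesis
    using card_succs2[OF assms(1) y]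
    by (simp only: card_image[OF inj[OF s(1)]] card_image[OF inj[OF s(2)]])
qed

section \<open>Alternating sums of level sizes\<close>

text \<open>Doubling either side counts the walks of length three from \<open>x\<close> to
  \<open>y\<close>, since a pair joined by a walk of length two is joined by exactly two of
  them.\<close>

lemma card_walks_1_2_commute:
  assumes "r \<ge> 2" "x < 2 * r + 2"
  shows "card {u \<in> succs r x. y \<in> succs2 r u} = card {u \<in> succs2 r x. y \<in> succs r u}"
proof -
  let ?V = "{..<2 * r + 2}"
  let ?g = "\<lambda>u v. (of_bool (u \<in> succs r x) * of_bool (v \<in> succs r u) * of_bool (y \<in> succs r v) :: nat)"
  have "2 * card {u \<in> succs r x. y \<in> succs2 r u} = (\<Sum>u\<in>?V. \<Sum>v\<in>?V. ?g u v)"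
  proof -
    have "(\<Sum>v\<in>?V. ?g u v) = 2 * of_bool (u \<in> succs r x \<and> y \<in> succs2 r u)" if u: "u < 2 * r + 2" for u
    proof -
      have "(\<Sum>v\<in>?V. ?g u v) = of_bool (u \<in> succs r x) * card {v \<in> succs r u. y \<in> succs r v}"
        using succs_less[OF assms(1) u]
        by (subst card_eq_sum, simp only: sum_distrib_left)
          (rule sum.mono_neutral_cong_right; auto)
      then show ?thesis by (simp add: card_two_step_walks[OF assms(1) u])
    qed
    then have "(\<Sum>u\<in>?V. \<Sum>v\<in>?V. ?g u v) = (\<Sum>u\<in>?V. 2 * of_bool (u \<in> succs r x \<and> y \<in> succs2 r u))"
      by (intro sum.cong) auto
    also have "\<dots> = 2 * card {u \<in> succs r x. y \<in> succs2 r u}"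
      using succs_less[OF assms]
      by (subst card_eq_sum, simp only: sum_distrib_left)
         (rule sum.mono_neutral_cong_right; auto)
    finally show ?thesis by simp
  qed
  moreover have "2 * card {v \<in> succs2 r x. y \<in> succs r v} = (\<Sum>v\<in>?V. \<Sum>u\<in>?V. ?g u v)"
  proof -
    have "(\<Sum>u\<in>?V. ?g u v) = 2 * of_bool (v \<in> succs2 r x \<and> y \<in> succs r v)" for v
    proof -
      have "(\<Sum>u\<in>?V. ?g u v) = of_bool (y \<in> succs r v) * card {u \<in> succs r x. v \<in> succs r u}"
        using succs_less[OF assms]
        by (subst card_eq_sum, simp only: sum_distrib_left)
          (rule sum.mono_neutral_cong_right; auto)
      then show ?thesis by (simp add: card_two_step_walks[OF assms])
    qed
    then have "(\<Sum>v\<in>?V. \<Sum>u\<in>?V. ?g u v) = (\<Sum>v\<in>?V. 2 * of_bool (v \<in> succs2 r x \<and> y \<in> succs r v))"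
      by (intro sum.cong) auto
    also have "\<dots> = 2 * card {v \<in> succs2 r x. y \<in> succs r v}"
      using succs2_less[OF assms(1)]
      by (subst card_eq_sum, simp only: sum_distrib_left)
         (rule sum.mono_neutral_cong_right; auto)
    finally show ?thesis by simp
  qed
  ultimately show ?thesis
    using sum.swap[of ?g ?V ?V] by simp
qed

text \<open>Inclusion-exclusion: \<open>succs2 r x\<close> contains \<open>{..r}\<close> and
  \<open>preds2 r y\<close> contains all vertices above \<open>r\<close>, so their union is
  everything. The 2 is left over from \<open>2 * r + 2\<close> after both excesses \<open>r\<close>
  are subtracted.\<close>

lemma card_walks_2_2:
  assumes "r \<ge> 2" "x < 2 * r + 2" "y < 2 * r + 2"
  shows "card {u \<in> succs2 r x. y \<in> succs2 r u} + 2 = card (succs r x) + card (preds r y)"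
proof -
  have "succs2 r x \<union> preds2 r y = {..<2 * r + 2}"
    using assms succs2_less[OF assms(1)] by (auto simp: preds2_def succs2_def split: if_splits)
  moreover have "succs2 r x \<inter> preds2 r y = {u \<in> succs2 r x. y \<in> succs2 r u}"
    using succs2_less[OF assms(1)] by (auto simp: preds2_def)
  ultimately have "card (succs2 r x) + card (preds2 r y) = 2 * r + 2 + card {u \<in> succs2 r x. y \<in> succs2 r u}"
    using card_Un_Int[of "succs2 r x" "preds2 r y"] by (simp add: preds2_def)
  then show ?thesis
    using card_succs2[OF assms(1,2)] card_preds2[OF assms(1,3)] by simp
qed

lemma sum_minus_one_power: "(\<Sum>i<n. (-1::int) ^ i) = of_bool (odd n)"
  by (induction n) auto

text \<open>Walks of length at least 3 join any two vertices, so in the sum only the terms with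
  \<open>q\<close> or \<open>p - q\<close> below 3 depend on \<open>x\<close> and \<open>y\<close>; by \<open>card_succs2\<close> and \<open>card_preds2\<close>
  each end contributes \<open>\<plusminus>(r + 1)\<close>, against the \<open>2 * r + 2\<close> of the terms in between.\<close>

lemma alternating_walk_count:
  assumes "r \<ge> 2" "x < 2 * r + 2" "y < 2 * r + 2" "p \<ge> 1" "(x, y) \<in> N_rel r ^^ p"
  shows "(\<Sum>q\<le>p. (-1) ^ q * int (card {u. (x, u) \<in> N_rel r ^^ q \<and> (u, y) \<in> N_rel r ^^ (p - q)})) = 0"
proof -
  \<comment> \<open>\<open>K q (p - q)\<close> is the number of elements on level \<open>q\<close>
    of an interval of length \<open>p\<close> from \<open>x\<close> to \<open>y\<close>.\<close>
  define K where "K q s = card {u. (x, u) \<in> N_rel r ^^ q \<and> (u, y) \<in> N_rel r ^^ s}" for q s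
  have rel1: "(u, v) \<in> N_rel r ^^ Suc 0 \<longleftrightarrow> u < 2 * r + 2 \<and> v \<in> succs r u" for u v
    by (simp add: N_rel_iff[OF assms(1)])
  have rel2: "(u, v) \<in> N_rel r ^^ Suc (Suc 0) \<longleftrightarrow> u < 2 * r + 2 \<and> v \<in> succs2 r u" for u v
    using N_rel_relpow_2[OF assms(1)] unfolding numeral_2_eq_2 .
  have rel3: "(u, v) \<in> N_rel r ^^ (n + 3) \<longleftrightarrow> u < 2 * r + 2 \<and> v < 2 * r + 2" for u v n
    using N_rel_relpow_ge_3[OF assms(1)] .
  have less: "u < 2 * r + 2" if "u \<in> succs r x \<or> u \<in> succs2 r x" for u
    using that succs_less[OF assms(1,2)] succs2_less[OF assms(1)] by blast
  have K0: "K 0 p = 1" "K p 0 = 1"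
  proof -
    have "{u. (x, u) \<in> N_rel r ^^ 0 \<and> (u, y) \<in> N_rel r ^^ p} = {x}"
      "{u. (x, u) \<in> N_rel r ^^ p \<and> (u, y) \<in> N_rel r ^^ 0} = {y}"
      using assms(5) by auto
    then show "K 0 p = 1" "K p 0 = 1" by (simp_all only: K_def) auto
  qed
  have K11: "K (Suc 0) (Suc 0) = (if y \<in> succs2 r x then 2 else 0)"
    unfolding K_def rel1 card_two_step_walks[OF assms(1,2), symmetric] using assms less
    by (intro arg_cong[where f = card]) auto
  have K12: "K (Suc 0) (Suc (Suc 0)) = card {u \<in> succs r x. y \<in> succs2 r u}"
    unfolding K_def rel1 rel2 using assms less by (intro arg_cong[where f = card]) auto
  have K21: "K (Suc (Suc 0)) (Suc 0) = card {u \<in> succs2 r x. y \<in> succs r u}"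
    unfolding K_def rel1 rel2 using assms less by (intro arg_cong[where f = card]) auto
  have K22: "K (Suc (Suc 0)) (Suc (Suc 0)) = card {u \<in> succs2 r x. y \<in> succs2 r u}"
    unfolding K_def rel1 rel2 using assms less by (intro arg_cong[where f = card]) auto
  have K13: "K (Suc 0) (n + 3) = card (succs r x)" for n
    unfolding K_def rel1 rel3 using assms less by (intro arg_cong[where f = card]) auto
  have K23: "K (Suc (Suc 0)) (n + 3) = card (succs2 r x)" for n
    unfolding K_def rel2 rel3 using assms less by (intro arg_cong[where f = card]) auto
  have K31: "K (n + 3) (Suc 0) = card (preds r y)" for n
    unfolding K_def rel1 rel3 preds_def using assms by (intro arg_cong[where f = card]) auto
  have K32: "K (n + 3) (Suc (Suc 0)) = card (preds2 r y)" for n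
    unfolding K_def rel2 rel3 preds2_def using assms by (intro arg_cong[where f = card]) auto
  have K33: "K (m + 3) (n + 3) = 2 * r + 2" for m n
  proof -
    have "K (m + 3) (n + 3) = card {..<2 * r + 2}"
      unfolding K_def rel3 using assms by (intro arg_cong[where f = card]) auto
    then show ?thesis by simp
  qed
  \<comment> \<open>The three lowest and the three highest levels are disjoint only from
    \<open>p = 5\<close> on, so shorter lengths are treated one by one.\<close>
  consider "p = 1" | "p = 2" | "p = 3" | "p = 4" | "p \<ge> 5"
    using assms(4) by linarith
  then have "(\<Sum>q\<le>p. (-1) ^ q * int (K q (p - q))) = 0"
  proof cases
    case 1
    then show ?thesis using K0 by simp
  next
    case 2
    then show ?thesis using K0 K11 assms(5) rel2 by (simp add: numeral_2_eq_2)
  next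
    case 3
    then show ?thesis using K0 K12 K21 card_walks_1_2_commute[OF assms(1,2)] by (simp add: numeral_3_eq_3)
  next
    case 4
    have "{..p} = {0, 1, 2, 3, 4}" using 4 by auto
    then have "(\<Sum>q\<le>p. (-1) ^ q * int (K q (p - q))) =
        int (K 0 p) - int (K 1 3) + int (K 2 2) - int (K 3 1) + int (K p 0)"
      using 4 by simp
    also have "\<dots> = 0"
      using K0 K13[of 0] K31[of 0] K22 card_walks_2_2[OF assms(1-3)] by (simp add: numeral_2_eq_2)
    finally show ?thesis .
  next
    case 5
    then obtain n where n: "p = n + 5"
      by (metis add.commute le_Suc_ex)
    let ?g = "\<lambda>q. (-1) ^ q * int (K q (p - q))"
    have "(\<Sum>q\<le>p. ?g q) = (\<Sum>q<n + 6. ?g q)"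
      using n by (intro sum.cong) auto
    also have "{..<n + 6} = {0, 1, 2} \<union> (\<lambda>i. i + 3) ` {..<n} \<union> {n + 3, n + 4, n + 5}"
      by (auto simp: image_iff Bex_def) presburger
    also have "sum ?g \<dots> = sum ?g {0, 1, 2} + sum ?g ((\<lambda>i. i + 3) ` {..<n}) + sum ?g {n + 3, n + 4, n + 5}"
      by (subst sum.union_disjoint; (subst sum.union_disjoint)?) auto
    also have "sum ?g ((\<lambda>i. i + 3) ` {..<n}) = (\<Sum>i<n. - ((-1) ^ i) * int (2 * r + 2))"
    proof (subst sum.reindex, simp, rule sum.cong[OF refl])
      fix i assume "i \<in> {..<n}"
      then obtain k where "n = i + 1 + k"
        by (metis add.commute less_iff_Suc_add lessThan_iff plus_1_eq_Suc add_Suc_right add_Suc)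
      then have "p - (i + 3) = k + 3" using n by simp
      then show "(?g \<circ> (\<lambda>i. i + 3)) i = - ((-1) ^ i) * int (2 * r + 2)"
        using K33[of i k] by (simp add: power_add)
    qed
    also have "\<dots> = - int (2 * r + 2) * of_bool (odd n)"
      by (simp add: sum_minus_one_power sum_negf flip: sum_distrib_right)
    also have "sum ?g {0, 1, 2} = 1 - int (card (succs r x)) + int (card (succs2 r x))"
      using K0 K13[of "n + 1"] K23[of n] n by (simp add: numeral_2_eq_2 numeral_eq_Suc)
    also have "sum ?g {n + 3, n + 4, n + 5} = - ((-1) ^ n) * (int (card (preds2 r y)) - int (card (preds r y)) + 1)"
      using K0 K31[of "n + 1"] K32[of n] n by (simp add: power_add algebra_simps numeral_eq_Suc)
    finally show ?thesis
      using card_succs2[OF assms(1,2)] card_preds2[OF assms(1,3)]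
      by (cases "even n") (auto simp: algebra_simps)
  qed
  then show ?thesis by (simp add: K_def)
qed


section \<open>Chains in intervals\<close>

text \<open>Chains live in the whole order instead of an interval, so removing the first element
  gives a chain over the same relation.\<close>

definition chains_between :: "'a rel \<Rightarrow> 'a \<Rightarrow> 'a \<Rightarrow> 'a list set" where
  "chains_between Q x y =
     {xs. length xs \<ge> 2 \<and> sorted_wrt (\<lambda>u v. (u, v) \<in> Q \<and> u \<noteq> v) xs \<and> hd xs = x \<and> last xs = y}"

lemma poset_interval_iff:
  assumes "Partial_order Q"
  shows "(u, v) \<in> poset_interval Q x y \<longleftrightarrow> (u, v) \<in> Q \<and> (x, u) \<in> Q \<and> (v, y) \<in> Q"
  using assms unfolding poset_interval_def
  by (auto simp: partial_order_on_def preorder_on_def dest: transD)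

lemma Field_poset_interval:
  assumes "Partial_order Q"
  shows "Field (poset_interval Q x y) = {z. (x, z) \<in> Q \<and> (z, y) \<in> Q}"
proof -
  have "(z, z) \<in> Q" if "(x, z) \<in> Q" for z
    using assms that by (auto simp: partial_order_on_def preorder_on_def intro: refl_onD FieldI2)
  then show ?thesis by (auto simp: poset_interval_def Field_def)
qed

lemma Partial_order_poset_interval:
  "Partial_order Q \<Longrightarrow> Partial_order (poset_interval Q x y)"
  unfolding poset_interval_def by (rule Partial_order_Restr)

lemma is_least_poset_interval:
  assumes "Partial_order Q" "(x, y) \<in> Q"
  shows "is_least (poset_interval Q x y) z \<longleftrightarrow> z = x"
proof -
  have "(x, x) \<in> Q" "antisym Q"
    using assms by (auto simp: partial_order_on_def preorder_on_def intro: refl_onD FieldI1)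
  then show ?thesis
    using assms(2) by (auto simp: is_least_def Field_poset_interval[OF assms(1)]
      poset_interval_iff[OF assms(1)] dest: antisymD)
qed

lemma is_greatest_poset_interval:
  assumes "Partial_order Q" "(x, y) \<in> Q"
  shows "is_greatest (poset_interval Q x y) z \<longleftrightarrow> z = y"
proof -
  have "(y, y) \<in> Q" "antisym Q"
    using assms by (auto simp: partial_order_on_def preorder_on_def intro: refl_onD FieldI2)
  then show ?thesis
    using assms(2) by (auto simp: is_greatest_def Field_poset_interval[OF assms(1)]
      poset_interval_iff[OF assms(1)] dest: antisymD)
qed

text \<open>By transitivity, anything between two elements of the interval lies in the interval
  itself.\<close>

lemma covers_poset_interval:
  assumes "Partial_order Q" "covers (poset_interval Q x y) u v"
  shows "covers Q u v"
proof -
  have "trans Q" using assms by (simp add: partial_order_on_def preorder_on_def)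
  then show ?thesis
    using assms(2) unfolding covers_def poset_interval_iff[OF assms(1)]
    by (meson transD)
qed

text \<open>All elements of a chain lie between its first and its last one, so restricting the order
  to the interval removes no chain.\<close>

lemma bounded_chains_poset_interval:
  assumes "Partial_order Q" "(x, y) \<in> Q"
  shows "bounded_chains (poset_interval Q x y) = chains_between Q x y"
proof -
  have refl: "(u, u) \<in> Q" if "(u, v) \<in> Q \<or> (v, u) \<in> Q" for u v
    using assms that
    by (auto simp: partial_order_on_def preorder_on_def intro: refl_onD FieldI1 FieldI2)
  have hd: "(hd xs, u) \<in> Q" and last: "(u, last xs) \<in> Q"
    if len: "length xs \<ge> 2" and sorted: "sorted_wrt (\<lambda>u v. (u, v) \<in> Q \<and> u \<noteq> v) xs"
      and u: "u \<in> set xs" for xs u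
  proof -
    obtain i where i: "i < length xs" "u = xs ! i"
      using u by (auto simp: in_set_conv_nth)
    have lt: "(xs ! k, xs ! l) \<in> Q" if "k < l" "l < length xs" for k l
      using sorted_wrt_nth_less[OF sorted that] by simp
    have le: "(xs ! k, xs ! l) \<in> Q" if "k \<le> l" "l < length xs" for k l
    proof (cases "k = l")
      \<comment> \<open>Reflexivity is available only on the field; as the list has two elements,
        \<open>xs ! l\<close> is related to another one and hence belongs to it.\<close>
      case True
      show ?thesis
      proof (cases "l = 0")
        case True
        then show ?thesis using \<open>k = l\<close> lt[of 0 1] len refl by force
      next
        case False
        then show ?thesis using \<open>k = l\<close> lt[of 0 l] that refl by force
      qed
    qed (use that lt in simp)
    show "(hd xs, u) \<in> Q" "(u, last xs) \<in> Q"
      using le[of 0 i] le[of i "length xs - 1"] i len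
      by (auto simp: hd_conv_nth last_conv_nth simp flip: length_greater_0_conv)
  qed
  have "sorted_wrt (\<lambda>u v. (u, v) \<in> poset_interval Q (hd xs) (last xs) \<and> u \<noteq> v) xs \<longleftrightarrow>
      sorted_wrt (\<lambda>u v. (u, v) \<in> Q \<and> u \<noteq> v) xs" if "length xs \<ge> 2" for xs
  proof
    assume sorted: "sorted_wrt (\<lambda>u v. (u, v) \<in> Q \<and> u \<noteq> v) xs"
    show "sorted_wrt (\<lambda>u v. (u, v) \<in> poset_interval Q (hd xs) (last xs) \<and> u \<noteq> v) xs"
    proof (rule sorted_wrt_mono_rel[OF _ sorted])
      fix u v assume uv: "u \<in> set xs" "v \<in> set xs" "(u, v) \<in> Q \<and> u \<noteq> v"
      show "(u, v) \<in> poset_interval Q (hd xs) (last xs) \<and> u \<noteq> v"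
        using uv(3) hd[OF that sorted uv(1)] last[OF that sorted uv(2)]
        by (simp add: poset_interval_iff[OF assms(1)])
    qed
  qed (erule sorted_wrt_mono_rel[rotated], auto simp: poset_interval_iff[OF assms(1)])
  then have "sorted_wrt (\<lambda>u v. (u, v) \<in> poset_interval Q x y \<and> u \<noteq> v) xs \<longleftrightarrow>
      sorted_wrt (\<lambda>u v. (u, v) \<in> Q \<and> u \<noteq> v) xs"
    if "length xs \<ge> 2" "hd xs = x" "last xs = y" for xs
    using that by blast
  then show ?thesis
    unfolding bounded_chains_def chains_between_def is_least_poset_interval[OF assms]
      is_greatest_poset_interval[OF assms]
    by blast
qed

lemma chains_between_imp_less:
  assumes "xs \<in> chains_between Q x y"
  shows "(x, y) \<in> Q \<and> x \<noteq> y"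
proof -
  obtain u zs where xs: "xs = u # zs" "zs \<noteq> []"
    using assms by (cases xs) (auto simp: chains_between_def Suc_le_eq)
  then show ?thesis
    using assms by (auto simp: chains_between_def)
qed

text \<open>This sorts the chains by their second element and is the source of the recursion for the
  ab-index.\<close>

lemma chains_between_rec:
  assumes "Partial_order Q"
  shows "chains_between Q x y =
    (if (x, y) \<in> Q \<and> x \<noteq> y then {[x, y]} else {}) \<union>
    (\<Union>z\<in>{z. (x, z) \<in> Q \<and> x \<noteq> z}. (#) x ` chains_between Q z y)" (is "?L = ?R")
proof (intro equalityI subsetI)
  fix xs assume xs: "xs \<in> ?L"
  then obtain zs where zs: "xs = x # zs" "zs \<noteq> []"
    by (cases xs) (auto simp: chains_between_def Suc_le_eq)
  show "xs \<in> ?R"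
  proof (cases "length zs \<ge> 2")
    case True
    then have "zs \<in> chains_between Q (hd zs) y" "(x, hd zs) \<in> Q" "x \<noteq> hd zs"
      using xs zs by (auto simp: chains_between_def)
    then show ?thesis using zs by auto
  next
    case False
    then have "zs = [y]"
      using xs zs by (cases zs) (auto simp: chains_between_def Suc_le_eq)
    then show ?thesis using xs zs by (auto simp: chains_between_def)
  qed
next
  fix xs assume xs: "xs \<in> ?R"
  show "xs \<in> ?L"
  proof (cases "xs = [x, y] \<and> (x, y) \<in> Q \<and> x \<noteq> y")
    case True then show ?thesis by (auto simp: chains_between_def)
  next
    case False
    then obtain z zs where z: "(x, z) \<in> Q" "x \<noteq> z" "zs \<in> chains_between Q z y" "xs = x # zs"
      using xs by (auto split: if_splits)
    then obtain zs' where zs: "zs = z # zs'" "zs' \<noteq> []"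
      by (cases zs) (auto simp: chains_between_def Suc_le_eq)
    have "trans Q" "antisym Q" using assms by (auto simp: partial_order_on_def preorder_on_def)
    then have "(x, w) \<in> Q \<and> x \<noteq> w" if "w \<in> set zs'" for w
      using z zs that by (auto simp: chains_between_def dest: transD antisymD)
    then show ?thesis using z zs by (auto simp: chains_between_def)
  qed
qed

lemma chains_between_disjoint:
  "z \<noteq> z' \<Longrightarrow> chains_between Q z y \<inter> chains_between Q z' y = {}"
  by (auto simp: chains_between_def)


section \<open>Eulerian intervals of level posets\<close>

lemma level_poset_less:
  assumes "((x, s), (y, t)) \<in> level_poset X"
  shows "(x, s) = (y, t) \<or> s < t"
  using assms by (auto simp: level_poset_iff)

text \<open>Length 0 is excluded because the zeroth power is the identity on all natural
  numbers.\<close>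

lemma mat_rel_relpow_less:
  assumes "square_mat X" "(x, y) \<in> mat_rel X ^^ n" "n \<ge> 1"
  shows "y < dim_row X"
proof -
  obtain m where n: "n = Suc m" using assms(3) by (cases n) auto
  show ?thesis using assms(1,2) unfolding n by (auto simp: mat_rel_def)
qed

text \<open>Parametrising the interval by height and vertex turns sums over it into sums of walk
  counts, level by level.\<close>

lemma level_interval:
  assumes "square_mat X" "x < dim_row X" "y < dim_row X"
  shows "{z. ((x, s), z) \<in> level_poset X \<and> (z, (y, s + int p)) \<in> level_poset X} =
    (\<lambda>(q, u). (u, s + int q)) ` (SIGMA q:{..p}. {u. (x, u) \<in> mat_rel X ^^ q \<and> (u, y) \<in> mat_rel X ^^ (p - q)})"
proof (intro equalityI subsetI)
  fix z assume z: "z \<in> {z. ((x, s), z) \<in> level_poset X \<and> (z, (y, s + int p)) \<in> level_poset X}"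
  obtain u t where zt: "z = (u, t)" by (cases z)
  with z have t: "s \<le> t" "t \<le> s + int p" and paths: "(x, u) \<in> mat_rel X ^^ nat (t - s)"
    "(u, y) \<in> mat_rel X ^^ nat (s + int p - t)"
    by (auto simp: level_poset_iff)
  have "nat (s + int p - t) = p - nat (t - s)" using t by simp
  then show "z \<in> (\<lambda>(q, u). (u, s + int q)) ` (SIGMA q:{..p}. {u. (x, u) \<in> mat_rel X ^^ q \<and> (u, y) \<in> mat_rel X ^^ (p - q)})"
    using t paths zt by (intro image_eqI[of _ _ "(nat (t - s), u)"]) auto
next
  fix z assume "z \<in> (\<lambda>(q, u). (u, s + int q)) ` (SIGMA q:{..p}. {u. (x, u) \<in> mat_rel X ^^ q \<and> (u, y) \<in> mat_rel X ^^ (p - q)})"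
  then obtain q u where z: "z = (u, s + int q)" "q \<le> p" "(x, u) \<in> mat_rel X ^^ q" "(u, y) \<in> mat_rel X ^^ (p - q)"
    by auto
  have "u < dim_row X"
  proof (cases "q = 0")
    case False then show ?thesis using mat_rel_relpow_less[OF assms(1) z(3)] by simp
  qed (use z assms in auto)
  moreover have "nat (s + int p - (s + int q)) = p - q" using z(2) by simp
  ultimately show "z \<in> {z. ((x, s), z) \<in> level_poset X \<and> (z, (y, s + int p)) \<in> level_poset X}"
    using z assms(2,3) by (simp add: level_poset_iff)
qed

lemma finite_relpow_between:
  assumes "square_mat X"
  shows "finite {u. (x, u) \<in> mat_rel X ^^ q \<and> P u}"
proof (cases "q = 0")
  case False
  then have "{u. (x, u) \<in> mat_rel X ^^ q \<and> P u} \<subseteq> {..<dim_row X}"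
    using mat_rel_relpow_less[OF assms] by force
  then show ?thesis using finite_subset by blast
qed simp

lemma finite_level_interval:
  assumes "square_mat X"
  shows "finite {z. (p, z) \<in> level_poset X \<and> (z, q) \<in> level_poset X}"
proof (cases "(p, q) \<in> level_poset X")
  case True
  obtain x s y t where pq: "p = (x, s)" "q = (y, t)" by (cases p, cases q)
  with True have lt: "x < dim_row X" "y < dim_row X" and t: "t = s + int (nat (t - s))"
    by (auto simp: level_poset_iff)
  show ?thesis
    unfolding pq by (subst t, subst level_interval[OF assms lt])
      (intro finite_imageI finite_SigmaI finite_relpow_between[OF assms] finite_atMost)
next
  case False
  have "trans (level_poset X)"
    using Partial_order_level_poset[of X] by (simp add: partial_order_on_def preorder_on_def)
  with False have none: "{z. (p, z) \<in> level_poset X \<and> (z, q) \<in> level_poset X} = {}"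
    by (auto dest: transD)
  show ?thesis unfolding none by simp
qed

text \<open>Translates the Eulerian condition into the vanishing of an alternating sum.\<close>

lemma card_even_minus_card_odd:
  fixes \<rho> :: "'a \<Rightarrow> nat"
  assumes "finite A"
  shows "int (card {z \<in> A. even (\<rho> z)}) - int (card {z \<in> A. odd (\<rho> z)}) = (\<Sum>z\<in>A. (-1) ^ \<rho> z)"
proof -
  have "A = {z \<in> A. even (\<rho> z)} \<union> {z \<in> A. odd (\<rho> z)}" by auto
  then have "(\<Sum>z\<in>A. (-1::int) ^ \<rho> z) =
      (\<Sum>z\<in>{z \<in> A. even (\<rho> z)}. (-1) ^ \<rho> z) + (\<Sum>z\<in>{z \<in> A. odd (\<rho> z)}. (-1) ^ \<rho> z)"
    using assms by (subst sum.union_disjoint[symmetric]) auto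
  also have "(\<Sum>z\<in>{z \<in> A. even (\<rho> z)}. (-1::int) ^ \<rho> z) = int (card {z \<in> A. even (\<rho> z)})"
    by simp
  also have "(\<Sum>z\<in>{z \<in> A. odd (\<rho> z)}. (-1::int) ^ \<rho> z) = - int (card {z \<in> A. odd (\<rho> z)})"
    by simp
  finally show ?thesis by simp
qed

text \<open>On intervals with bottom at level 0 all levels are nonnegative, so \<open>nat\<close>
  loses nothing.\<close>

definition level_rank :: "nat \<times> int \<Rightarrow> nat" where
  "level_rank z = nat (snd z)"

lemma graded_level_interval:
  assumes "square_mat X" "((x, 0), (y, t)) \<in> level_poset X"
  shows "graded_poset (poset_interval (level_poset X) (x, 0) (y, t)) level_rank"
proof -
  note po = Partial_order_level_poset[of X]
  let ?P = "poset_interval (level_poset X) (x, 0) (y, t)"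
  have "level_rank v = level_rank u + 1" if "covers ?P u v" for u v
  proof -
    have "(u, v) \<in> level_covers X"
      using covers_poset_interval[OF po that] covers_level_poset[OF assms(1)] by blast
    moreover have "((x, 0), u) \<in> level_poset X"
      using that by (simp add: covers_def poset_interval_iff[OF po])
    ultimately show ?thesis
      by (cases u) (auto simp: level_covers_def level_poset_iff level_rank_def)
  qed
  moreover have "finite (Field ?P)"
    unfolding Field_poset_interval[OF po] by (rule finite_level_interval[OF assms(1)])
  moreover have "is_least ?P (x, 0)" "is_greatest ?P (y, t)"
    by (simp_all add: is_least_poset_interval[OF po assms(2)] is_greatest_poset_interval[OF po assms(2)])
  ultimately show ?thesis
    using Partial_order_poset_interval[OF po]
    by (auto simp: graded_poset_def level_rank_def intro!: exI[of _ "(x, 0)"])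
qed

text \<open>Summed level by level, the signed count of a subinterval is the alternating walk sum
  between its end vertices; the level of its bottom contributes only a global sign.\<close>

lemma eulerian_level_interval:
  assumes X: "square_mat X" and xy: "((x, 0), (y, t)) \<in> level_poset X"
    and alternating: "\<And>u v p. u < dim_row X \<Longrightarrow> v < dim_row X \<Longrightarrow> p \<ge> 1 \<Longrightarrow> (u, v) \<in> mat_rel X ^^ p \<Longrightarrow>
      (\<Sum>q\<le>p. (-1) ^ q * int (card {w. (u, w) \<in> mat_rel X ^^ q \<and> (w, v) \<in> mat_rel X ^^ (p - q)})) = 0"
  shows "eulerian_poset (poset_interval (level_poset X) (x, 0) (y, t)) level_rank"
proof -
  note po = Partial_order_level_poset[of X]
  let ?P = "poset_interval (level_poset X) (x, 0) (y, t)"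
  have "card {z. (a, z) \<in> ?P \<and> (z, b) \<in> ?P \<and> even (level_rank z)} =
        card {z. (a, z) \<in> ?P \<and> (z, b) \<in> ?P \<and> odd (level_rank z)}"
    if ab: "(a, b) \<in> ?P" "a \<noteq> b" for a b
  proof -
    obtain u s v s' where uv: "a = (u, s)" "b = (v, s')" by (cases a, cases b)
    define p where "p = nat (s' - s)"
    have le: "((x, 0), (u, s)) \<in> level_poset X" "((u, s), (v, s')) \<in> level_poset X"
      using ab uv by (simp_all add: poset_interval_iff[OF po])
    then have s: "s \<ge> 0" and s': "s' = s + int p" and p: "p \<ge> 1"
      and lt: "u < dim_row X" "v < dim_row X" and path: "(u, v) \<in> mat_rel X ^^ p"
      using level_poset_less[OF le(2)] ab(2) uv by (auto simp: level_poset_iff p_def)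
    define A where "A = {z. (a, z) \<in> level_poset X \<and> (z, b) \<in> level_poset X}"
    let ?B = "\<lambda>q. {w. (u, w) \<in> mat_rel X ^^ q \<and> (w, v) \<in> mat_rel X ^^ (p - q)}"
    have "trans (level_poset X)" using po by (simp add: partial_order_on_def preorder_on_def)
    then have P_A: "(a, z) \<in> ?P \<and> (z, b) \<in> ?P \<longleftrightarrow> z \<in> A" for z
      using ab(1) unfolding A_def mem_Collect_eq poset_interval_iff[OF po] by (meson transD)
    have "finite A" unfolding A_def by (rule finite_level_interval[OF X])
    moreover have "(\<Sum>z\<in>A. (-1::int) ^ level_rank z) = 0"
    proof -
      have A: "A = (\<lambda>(q, w). (w, s + int q)) ` (SIGMA q:{..p}. ?B q)"
        unfolding A_def uv s' by (rule level_interval[OF X lt])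
      have "(\<Sum>z\<in>A. (-1::int) ^ level_rank z) = (\<Sum>(q, w)\<in>(SIGMA q:{..p}. ?B q). (-1) ^ (nat s + q))"
        unfolding A by (subst sum.reindex)
          (use s in \<open>auto simp: inj_on_def level_rank_def nat_add_distrib intro!: sum.cong\<close>)
      also have "\<dots> = (\<Sum>q\<le>p. \<Sum>w\<in>?B q. (-1) ^ (nat s + q))"
        by (subst sum.Sigma) (auto intro: finite_relpow_between[OF X])
      also have "\<dots> = (-1) ^ nat s * (\<Sum>q\<le>p. (-1) ^ q * int (card (?B q)))"
        by (simp add: sum_distrib_left power_add mult_ac)
      finally show ?thesis using alternating[OF lt p path] by simp
    qed
    ultimately show ?thesis
      using card_even_minus_card_odd[of A level_rank] by (simp add: P_A conj_assoc[symmetric])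
  qed
  then show ?thesis
    using graded_level_interval[OF X xy] by (simp add: eulerian_poset_def)
qed


section \<open>The recursion for the cd-index\<close>

text \<open>The index is shifted: \<open>cd_rec c d r (Suc k)\<close> is the polynomial of degree \<open>k\<close>, which makes
  \<open>n\<close> the length of an interval whose ab-index is \<open>cd_rec c d r n\<close>.\<close>

fun cd_rec :: "'a::ring_1 \<Rightarrow> 'a \<Rightarrow> nat \<Rightarrow> nat \<Rightarrow> 'a" where
  "cd_rec c d r 0 = 0"
| "cd_rec c d r (Suc 0) = 1"
| "cd_rec c d r (Suc (Suc n)) = c * cd_rec c d r (Suc n) + of_nat r * d * cd_rec c d r n"

section \<open>Weighted sums over cd-words\<close>

lemma letters_plus: "letters (u + v) = letters u @ letters v"
  by (simp add: plus_word_def)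

text \<open>\<open>keys\<close> omits the words with coefficient zero, but their terms vanish, so
  the sum may run over all of \<open>W\<close>.\<close>

lemma ncsubst_sum_single:
  assumes "finite W"
  shows "ncsubst f (\<Sum>w\<in>W. Poly_Mapping.single w (g w)) =
    (\<Sum>w\<in>W. of_int (g w) * prod_list (map f (letters w)))"
proof -
  let ?p = "\<Sum>w\<in>W. Poly_Mapping.single w (g w)"
  have lookup: "Poly_Mapping.lookup ?p w = (if w \<in> W then g w else 0)" for w
    using assms by (simp add: lookup_sum lookup_single when_def)
  then have "Poly_Mapping.keys ?p = {w \<in> W. g w \<noteq> 0}"
    by (auto simp: in_keys_iff split: if_splits)
  then have "ncsubst f ?p = (\<Sum>w\<in>{w \<in> W. g w \<noteq> 0}. of_int (g w) * prod_list (map f (letters w)))"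
    unfolding ncsubst_def by (intro sum.cong) (auto simp: lookup)
  also have "\<dots> = (\<Sum>w\<in>W. of_int (g w) * prod_list (map f (letters w)))"
    using assms by (intro sum.mono_neutral_left) auto
  finally show ?thesis .
qed

lemma cd_words_0: "{w. cd_degree w = 0} = {Word []}"
proof -
  have "letters w = []" if "cd_degree w = 0" for w
  proof (cases "letters w")
    case (Cons x xs)
    then show ?thesis using that by (cases x) (auto simp: cd_degree_def)
  qed
  then show ?thesis by (auto simp: cd_degree_def word.expand)
qed

lemma cd_words_1: "{w. cd_degree w = 1} = {Word [Var_c]}"
proof -
  have "letters w = [Var_c]" if "cd_degree w = 1" for w
  proof (cases "letters w")
    case Nil then show ?thesis using that by (simp add: cd_degree_def)
  next
    case (Cons x xs)
    then have "x = Var_c" "cd_degree (Word xs) = 0"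
      using that by (cases x; simp add: cd_degree_def)+
    then show ?thesis using Cons cd_words_0 by auto
  qed
  then show ?thesis by (auto simp: cd_degree_def intro: word.expand)
qed

lemma cd_words_Suc_Suc:
  "{w. cd_degree w = Suc (Suc k)} =
     (+) (Word [Var_c]) ` {w. cd_degree w = Suc k} \<union> (+) (Word [Var_d]) ` {w. cd_degree w = k}"
proof (rule Set.set_eqI)
  fix w
  show "w \<in> {w. cd_degree w = Suc (Suc k)} \<longleftrightarrow> w \<in>
     (+) (Word [Var_c]) ` {w. cd_degree w = Suc k} \<union> (+) (Word [Var_d]) ` {w. cd_degree w = k}"
  proof
    assume w: "w \<in> {w. cd_degree w = Suc (Suc k)}"
    obtain xs where xs: "w = Word xs" by (cases w)
    show "w \<in> (+) (Word [Var_c]) ` {w. cd_degree w = Suc k} \<union> (+) (Word [Var_d]) ` {w. cd_degree w = k}"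
    proof (cases xs)
      case Nil then show ?thesis using w xs by (simp add: cd_degree_def)
    next
      case (Cons y ys)
      then have "w = Word [y] + Word ys" using xs by (simp add: plus_word_def)
      then show ?thesis using w by (cases y) (auto simp: cd_degree_def letters_plus)
    qed
  qed (auto simp: cd_degree_def letters_plus)
qed

text \<open>Splitting off the first letter produces the two summands of \<open>cd_rec\<close>; the
  integer coefficients are central and move past that letter.\<close>

lemma sum_cd_words:
  fixes f :: "cd \<Rightarrow> 'a::ring_1"
  shows "(\<Sum>w\<in>{w. cd_degree w = k}. of_int (int r ^ num_d w) * prod_list (map f (letters w))) =
    cd_rec (f Var_c) (f Var_d) r (Suc k)"
proof -
  define g where "g w = of_int (int r ^ num_d w) * prod_list (map f (letters w))" for w
  have c: "g (Word [Var_c] + w) = f Var_c * g w" for w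
  proof -
    have "g (Word [Var_c] + w) = (of_int (int r ^ num_d w) * f Var_c) * prod_list (map f (letters w))"
      by (simp add: g_def num_d_def letters_plus mult.assoc)
    also have "\<dots> = f Var_c * g w"
      by (subst mult_of_int_commute) (simp add: g_def mult.assoc)
    finally show ?thesis .
  qed
  have d: "g (Word [Var_d] + w) = of_nat r * f Var_d * g w" for w
  proof -
    have "g (Word [Var_d] + w) = of_nat r * (of_int (int r ^ num_d w) * f Var_d) * prod_list (map f (letters w))"
      by (simp add: g_def num_d_def letters_plus mult.assoc)
    also have "\<dots> = of_nat r * f Var_d * g w"
      by (subst mult_of_int_commute) (simp add: g_def mult.assoc)
    finally show ?thesis .
  qed
  have inj: "inj_on ((+) (Word [y])) W" for y :: cd and W
    by (auto simp: inj_on_def plus_word_def intro: word.expand)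
  have "sum g {w. cd_degree w = k} = cd_rec (f Var_c) (f Var_d) r (Suc k)"
  proof (induction k rule: induct_nat_012)
    case 0 then show ?case by (simp add: cd_words_0 g_def num_d_def)
  next
    case 1 then show ?case using cd_words_1 by (simp add: g_def num_d_def)
  next
    case (ge2 k)
    have "sum g {w. cd_degree w = Suc (Suc k)} =
        sum g ((+) (Word [Var_c]) ` {w. cd_degree w = Suc k}) +
        sum g ((+) (Word [Var_d]) ` {w. cd_degree w = k})"
      unfolding cd_words_Suc_Suc
      by (rule sum.union_disjoint) (auto simp: finite_cd_words plus_word_def)
    also have "\<dots> = f Var_c * sum g {w. cd_degree w = Suc k} +
        of_nat r * f Var_d * sum g {w. cd_degree w = k}"
      by (simp add: sum.reindex[OF inj] c d sum_distrib_left)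
    finally show ?case unfolding ge2 by simp
  qed
  then show ?thesis by (simp add: g_def)
qed

lemma cd_to_ab_sum:
  "cd_to_ab (\<Sum>w\<in>{w. cd_degree w = k}. Poly_Mapping.single w (int r ^ num_d w)) =
    cd_rec (ab_a + ab_b) (ab_a * ab_b + ab_b * ab_a) r (Suc k)"
  by (simp only: cd_to_ab_def ncsubst_sum_single[OF finite_cd_words] sum_cd_words cd_value.simps)

text \<open>With \<open>v\<close> the ab-indices of the intervals of length \<open>n\<close> below a fixed vertex \<open>j\<close>, the terms
  with \<open>q \<ge> 3\<close> do not depend on \<open>x\<close> and are collected in \<open>R\<close>. What remains closes up on three
  quantities: the common value at the vertices above \<open>r\<close>, the common value at \<open>2, \<dots>, r\<close>,
  and the sum \<open>T\<close> over all vertices up to \<open>r\<close>.\<close>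

lemma chain_recursion_solution:
  fixes a b :: "'a::ring_1" and v :: "nat \<Rightarrow> nat \<Rightarrow> 'a"
  defines "c \<equiv> a + b" and "d \<equiv> a * b + b * a" and "e \<equiv> a - b"
  assumes r: "r \<ge> 2" and j: "j \<le> r" and v0: "\<And>x. v 0 x = 0"
    and rec: "\<And>n x. 1 \<le> n \<Longrightarrow> n \<le> M \<Longrightarrow> x < 2 * r + 2 \<Longrightarrow>
      v n x = of_bool ((x, j) \<in> N_rel r ^^ n) * e ^ (n - 1) +
        (\<Sum>q\<in>{1..<n}. \<Sum>w\<in>{w. (x, w) \<in> N_rel r ^^ q}. e ^ (q - 1) * b * v (n - q) w)"
    and n: "n \<le> M" and x: "x \<in> {r + 1..2 * r + 1}"
  shows "v n x = cd_rec c d r n"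
proof -
  let ?A = "cd_rec c d r"
  \<comment> \<open>\<open>A'\<close> is \<open>?A\<close> delayed by one step; it is unrelated to
    the block of that name.\<close>
  define A' where "A' n = (case n of 0 \<Rightarrow> 0 | Suc m \<Rightarrow> ?A m)" for n
  define T where "T n = (\<Sum>x\<le>r. v n x)" for n
  define S where "S n = (\<Sum>x<2 * r + 2. v n x)" for n
  define R where "R n = e ^ (n - 1) + (\<Sum>q\<in>{3..<n}. e ^ (q - 1) * b * S (n - q))" for n
  have rel1: "(u, w) \<in> N_rel r ^^ Suc 0 \<longleftrightarrow> u < 2 * r + 2 \<and> w \<in> succs r u" for u w
    by (simp add: N_rel_iff[OF r])
  have rel2: "(u, w) \<in> N_rel r ^^ Suc (Suc 0) \<longleftrightarrow> u < 2 * r + 2 \<and> w \<in> succs2 r u" for u w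
    using N_rel_relpow_2[OF r] unfolding numeral_2_eq_2 .
  have rel3: "(u, w) \<in> N_rel r ^^ q \<longleftrightarrow> u < 2 * r + 2 \<and> w < 2 * r + 2" if "q \<ge> 3" for u w q
    using N_rel_relpow_ge_3[OF r, of u w "q - 3"] that by simp
  have S0: "S 0 = 0" by (simp add: S_def v0)
  have step: "v (Suc (Suc n)) x = R (Suc (Suc n)) + b * (\<Sum>w\<in>succs r x. v (Suc n) w) +
      e * b * (\<Sum>w\<in>succs2 r x. v n w)"
    if "Suc (Suc n) \<le> M" and x: "x < 2 * r + 2" for n x
  proof -
    define g where "g q = (\<Sum>w\<in>{w. (x, w) \<in> N_rel r ^^ q}. e ^ (q - 1) * b * v (Suc (Suc n) - q) w)" for q
    \<comment> \<open>From length two on the indicator is 1, as every \<open>succs2\<close> contains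
      \<open>{..r}\<close> and thus \<open>j\<close>.\<close>
    have "(x, j) \<in> N_rel r ^^ Suc (Suc n)"
    proof (cases n)
      case 0
      then show ?thesis using r x j unfolding 0 rel2 by (simp add: succs2_def)
    next
      case (Suc k)
      then have "3 \<le> Suc (Suc n)" by simp
      from rel3[OF this] show ?thesis using j x by simp
    qed
    then have "v (Suc (Suc n)) x = e ^ Suc n + sum g {1..<Suc (Suc n)}"
      using rec[OF _ that] by (simp add: g_def)
    also have "{1..<Suc (Suc n)} = insert 1 ({2..<Suc (Suc n)})" by auto
    also have "sum g \<dots> = g 1 + sum g {2..<Suc (Suc n)}" by simp
    \<comment> \<open>For \<open>n = 0\<close> the range is empty, and \<open>g 2\<close> vanishes
      because \<open>v 0\<close> does.\<close>
    also have "sum g {2..<Suc (Suc n)} = g 2 + sum g {3..<Suc (Suc n)}"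
    proof (cases n)
      case 0
      then show ?thesis by (simp add: g_def v0 numeral_2_eq_2)
    next
      case (Suc k)
      have "{2..<Suc (Suc n)} = insert 2 {3..<Suc (Suc n)}" using Suc by auto
      then show ?thesis by simp
    qed
    also have "sum g {3..<Suc (Suc n)} = (\<Sum>q\<in>{3..<Suc (Suc n)}. e ^ (q - 1) * b * S (Suc (Suc n) - q))"
    proof (rule sum.cong[OF refl])
      fix q assume "q \<in> {3..<Suc (Suc n)}"
      then have "{w. (x, w) \<in> N_rel r ^^ q} = {..<2 * r + 2}" using rel3 x by auto
      then show "g q = e ^ (q - 1) * b * S (Suc (Suc n) - q)"
        by (simp only: g_def S_def sum_distrib_left)
    qed
    also have "g 1 = b * (\<Sum>w\<in>succs r x. v (Suc n) w)"
      using x by (simp add: g_def N_rel_iff[OF r] sum_distrib_left)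
    also have "g 2 = e * b * (\<Sum>w\<in>succs2 r x. v n w)"
      using x by (simp add: g_def N_rel_relpow_2[OF r] sum_distrib_left)
    finally show ?thesis by (simp add: R_def algebra_simps)
  qed
  \<comment> \<open>Lengthening the interval by one shifts \<open>q\<close> and multiplies the old
    terms by \<open>e\<close>; the new term is the one with \<open>q = 3\<close>.\<close>
  have R_Suc: "R (Suc (Suc (Suc n))) = e * R (Suc (Suc n)) + e * e * b * S n" for n
  proof (cases n)
    case 0
    then show ?thesis by (simp add: R_def S0 numeral_eq_Suc)
  next
    case (Suc k)
    define h where "h q = e ^ (q - 1) * b * S (Suc (Suc (Suc n)) - q)" for q
    have "{3..<Suc (Suc (Suc n))} = insert 3 (Suc ` {3..<Suc (Suc n)})"
      using Suc by (auto simp: image_Suc_atLeastLessThan)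
    then have "sum h {3..<Suc (Suc (Suc n))} = h 3 + sum h (Suc ` {3..<Suc (Suc n)})"
      by (simp only:) (rule sum.insert, auto)
    also have "sum h (Suc ` {3..<Suc (Suc n)}) = (\<Sum>q\<in>{3..<Suc (Suc n)}. e ^ q * b * S (Suc (Suc n) - q))"
      by (simp add: sum.reindex h_def del: image_Suc_atLeastLessThan sum.op_ivl_Suc)
    also have "h 3 = e ^ 2 * b * S n"
      by (simp add: h_def numeral_eq_Suc)
    also have "(\<Sum>q\<in>{3..<Suc (Suc n)}. e ^ q * b * S (Suc (Suc n) - q)) =
        e * (\<Sum>q\<in>{3..<Suc (Suc n)}. e ^ (q - 1) * b * S (Suc (Suc n) - q))"
      unfolding sum_distrib_left
    proof (rule sum.cong[OF refl])
      fix q assume "q \<in> {3..<Suc (Suc n)}"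
      then obtain q' where "q = Suc q'" by (cases q) auto
      then show "e ^ q * b * S (Suc (Suc n) - q) = e * (e ^ (q - 1) * b * S (Suc (Suc n) - q))"
        by (simp add: mult.assoc)
    qed
    finally have "sum h {3..<Suc (Suc (Suc n))} =
        e ^ 2 * b * S n + e * (\<Sum>q\<in>{3..<Suc (Suc n)}. e ^ (q - 1) * b * S (Suc (Suc n) - q))" .
    moreover have "R (Suc (Suc (Suc n))) = e ^ Suc (Suc n) + sum h {3..<Suc (Suc (Suc n))}"
      by (simp add: R_def h_def del: sum.op_ivl_Suc)
    ultimately show ?thesis
      by (simp add: R_def[of "Suc (Suc n)"] distrib_left add.assoc add.left_commute power2_eq_square
        del: sum.op_ivl_Suc)
  qed
  define P where "P n \<longleftrightarrow> (\<forall>u\<in>{r + 1..2 * r + 1}. v n u = ?A n) \<and> (\<forall>t\<in>{2..r}. v n t = c * A' n) \<and>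
    T n = ?A n + of_nat r * c * A' n" for n
  have split: "S n = T n + (\<Sum>x\<in>{r + 1..2 * r + 1}. v n x)" for n
  proof -
    have "{..<2 * r + 2} = {..r} \<union> {r + 1..2 * r + 1}" by auto
    then show ?thesis unfolding S_def T_def by (simp only:) (rule sum.union_disjoint, auto)
  qed
  have S_eq: "S n = T n + of_nat (r + 1) * ?A n" if "P n" for n
    using that by (simp add: split P_def)
  have init: "{..r} = insert r {..<r}" by auto
  have T_init: "(\<Sum>x<r. v n x) = T n - v n r" for n
    by (simp add: T_def init)
  \<comment> \<open>The vertices 0 and 1 enter only together, inside \<open>{..<r}\<close> or
    \<open>{..r}\<close>. Hence \<open>T\<close>, the value at \<open>r\<close> and the common value
    above \<open>r\<close> determine all these sums.\<close>
  have succs_sum: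
    "(\<Sum>w\<in>succs r 0. v n w) = T n - c * A' n + ?A n"
    "(\<Sum>w\<in>succs r 1. v n w) = c * A' n + ?A n + ?A n"
    "\<And>t. t \<in> {2..r} \<Longrightarrow> (\<Sum>w\<in>succs r t. v n w) = ?A n + ?A n"
    "\<And>u. u \<in> {r + 1..2 * r + 1} \<Longrightarrow> (\<Sum>w\<in>succs r u. v n w) = T n + ?A n"
    if "P n" for n
  proof -
    have L: "v n u = ?A n" if "r + 1 \<le> u" "u \<le> 2 * r + 1" for u using \<open>P n\<close> that by (auto simp: P_def)
    have vr: "v n r = c * A' n" using \<open>P n\<close> r by (auto simp: P_def)
    show "(\<Sum>w\<in>succs r 0. v n w) = T n - c * A' n + ?A n"
      by (simp add: succs_def T_init vr L)
    show "(\<Sum>w\<in>succs r 1. v n w) = c * A' n + ?A n + ?A n"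
      using r by (simp add: succs_def vr L add.assoc)
    show "(\<Sum>w\<in>succs r t. v n w) = ?A n + ?A n" if "t \<in> {2..r}" for t
      using that by (simp add: succs_def L)
    show "(\<Sum>w\<in>succs r u. v n w) = T n + ?A n" if "u \<in> {r + 1..2 * r + 1}" for u
      using that r by (auto simp: succs_def L T_def add.commute)
  qed
  have succs2_sum:
    "(\<Sum>w\<in>succs2 r 0. v n w) = S n - ?A n"
    "(\<Sum>w\<in>succs2 r 1. v n w) = T n + ?A n + ?A n"
    "\<And>t. t \<in> {2..r} \<Longrightarrow> (\<Sum>w\<in>succs2 r t. v n w) = T n + ?A n"
    "\<And>u. u \<in> {r + 1..2 * r + 1} \<Longrightarrow> (\<Sum>w\<in>succs2 r u. v n w) = S n"
    if "P n" for n
  proof -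
    have L: "v n u = ?A n" if "r + 1 \<le> u" "u \<le> 2 * r + 1" for u using \<open>P n\<close> that by (auto simp: P_def)
    have "{..<2 * r + 2} = insert (2 * r + 1) {..2 * r}" by auto
    then have "S n = v n (2 * r + 1) + (\<Sum>w\<le>2 * r. v n w)" by (simp add: S_def)
    then show "(\<Sum>w\<in>succs2 r 0. v n w) = S n - ?A n"
      by (simp add: succs2_def L)
    show "(\<Sum>w\<in>succs2 r 1. v n w) = T n + ?A n + ?A n"
      using r by (simp add: succs2_def L T_def algebra_simps)
    show "(\<Sum>w\<in>succs2 r t. v n w) = T n + ?A n" if "t \<in> {2..r}" for t
      using that by (simp add: succs2_def L T_def add.commute)
    show "(\<Sum>w\<in>succs2 r u. v n w) = S n" if "u \<in> {r + 1..2 * r + 1}" for u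
      using that r by (simp add: succs2_def S_def lessThan_Suc_atMost)
  qed
  have P0: "P 0" by (simp add: P_def v0 A'_def T_def)
  have P1: "P 1" if "1 \<le> M"
  proof -
    have v1: "v (Suc 0) x = of_bool (j \<in> succs r x)" if "x < 2 * r + 2" for x
      using rec[OF _ \<open>1 \<le> M\<close> that] that by (simp add: N_rel_iff[OF r])
    \<comment> \<open>Among the vertices up to \<open>r\<close>, exactly one has an edge to
      \<open>j\<close>: vertex 0 if \<open>j < r\<close>, vertex 1 if \<open>j = r\<close>.\<close>
    have "T 1 = (\<Sum>x\<le>r. if x = (if j < r then 0 else 1) then 1 else 0)"
      unfolding T_def using r j by (intro sum.cong) (auto simp: v1 succs_def)
    also have "\<dots> = 1" using r by (subst sum.delta) auto
    finally show ?thesis using r j by (auto simp: P_def v1 A'_def succs_def)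
  qed
  \<comment> \<open>The equation for \<open>R\<close> comes from a vertex above \<open>r\<close> one
    length earlier: remove the chains whose second element is one level up, which amount to
    \<open>b * (T n + ?A n)\<close>, and multiply the rest by \<open>e\<close>.\<close>
  have P_step: "P (Suc (Suc n)) \<and> R (Suc (Suc (Suc n))) = e * (?A (Suc (Suc n)) - b * (T (Suc n) + ?A (Suc n)))"
    if P: "P n" "P (Suc n)" and R_eq: "R (Suc (Suc n)) = e * (?A (Suc n) - b * (T n + ?A n))"
      and M: "Suc (Suc n) \<le> M" for n
  proof -
    note vs = step[OF M]
    have L_vals: "v (Suc (Suc n)) u = R (Suc (Suc n)) + b * (T (Suc n) + ?A (Suc n)) + e * b * S n"
      if "u \<in> {r + 1..2 * r + 1}" for u
      using vs[of u] that succs_sum(4)[OF P(2) that] succs2_sum(4)[OF P(1) that] by simp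
    have T_n: "T n = ?A n + of_nat r * c * A' n" "T (Suc n) = ?A (Suc n) + of_nat r * c * ?A n"
      using P by (simp_all add: P_def A'_def)
    have of_nat_comm: "of_nat r * y = y * of_nat r" "of_nat r * (y * z) = y * (of_nat r * z)" for y z :: 'a
      by (simp_all only: mult_of_nat_commute[of r y] mult.assoc[symmetric])
    \<comment> \<open>This and the next three computations rest on \<open>e + 2 * b = c\<close> and
      \<open>e * b + b * c = d\<close>.\<close>
    have L: "v (Suc (Suc n)) u = ?A (Suc (Suc n))" if "u \<in> {r + 1..2 * r + 1}" for u
      unfolding L_vals[OF that] S_eq[OF P(1)] R_eq T_n
      by (simp add: algebra_simps c_def d_def e_def of_nat_comm)
    have Z: "v (Suc (Suc n)) t = c * ?A (Suc n)" if "t \<in> {2..r}" for t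
      using vs[of t] that succs_sum(3)[OF P(2) that] succs2_sum(3)[OF P(1) that]
      by (simp add: R_eq algebra_simps c_def e_def)
    have X: "v (Suc (Suc n)) 0 = c * ?A (Suc n) + of_nat r * d * ?A n - d * ?A n"
      using vs[of 0] succs_sum(1)[OF P(2)] succs2_sum(1)[OF P(1)]
      by (simp add: R_eq S_eq[OF P(1)] T_n A'_def algebra_simps c_def d_def e_def of_nat_comm)
    have Y: "v (Suc (Suc n)) 1 = c * ?A (Suc n) + d * ?A n"
      using vs[of 1] succs_sum(2)[OF P(2)] succs2_sum(2)[OF P(1)]
      by (simp add: R_eq T_n A'_def algebra_simps c_def d_def e_def of_nat_comm)
    \<comment> \<open>In the sum of \<open>X\<close> and \<open>Y\<close> the terms
      \<open>d * ?A n\<close> cancel, leaving \<open>of_nat r * d * ?A n\<close>.\<close>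
    have "{..r} = {0, 1} \<union> {2..r}" using r by auto
    then have "T (Suc (Suc n)) = v (Suc (Suc n)) 0 + v (Suc (Suc n)) 1 + (\<Sum>t\<in>{2..r}. v (Suc (Suc n)) t)"
      unfolding T_def by (simp only:) (subst sum.union_disjoint, auto)
    also have "\<dots> = ?A (Suc (Suc n)) + of_nat r * c * ?A (Suc n)"
      using r unfolding X Y by (simp add: Z of_nat_diff algebra_simps)
    finally have "P (Suc (Suc n))" using L Z by (simp add: P_def A'_def)
    moreover have "R (Suc (Suc n)) + e * b * S n = ?A (Suc (Suc n)) - b * (T (Suc n) + ?A (Suc n))"
      using L_vals[of "r + 1"] L[of "r + 1"] by (simp add: algebra_simps)
    then have "R (Suc (Suc (Suc n))) = e * (?A (Suc (Suc n)) - b * (T (Suc n) + ?A (Suc n)))"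
      unfolding R_Suc by (metis distrib_left mult.assoc)
    ultimately show ?thesis by blast
  qed
  have "P n \<and> P (Suc n) \<and> R (Suc (Suc n)) = e * (?A (Suc n) - b * (T n + ?A n))" if "Suc n \<le> M" for n
    using that
  proof (induction n)
    case 0
    then show ?case using P0 P1 by (simp add: R_def P_def A'_def)
  next
    case (Suc n)
    then show ?case using P_step[of n] by simp
  qed
  then have "P n"
    using P0 n by (cases n) auto
  then show ?thesis using x by (simp add: P_def)
qed

section \<open>Chain sums in the level poset\<close>

text \<open>The top stays fixed at level \<open>K\<close> and the start lies \<open>n\<close> levels
  below, so chains continued from a second element belong to the same family. For
  \<open>n \<le> K\<close> no level is negative.\<close>

definition chain_sum :: "int mat \<Rightarrow> nat \<Rightarrow> nat \<Rightarrow> nat \<Rightarrow> nat \<Rightarrow> ab ncpoly" where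
  "chain_sum X j K n u =
     (\<Sum>xs\<in>chains_between (level_poset X) (u, int K - int n) (j, int K). chain_weight level_rank xs)"

lemma chains_level_rec:
  assumes X: "square_mat X" and u: "u < dim_row X" "j < dim_row X"
  shows "chains_between (level_poset X) (u, t - int (Suc n)) (j, t) =
    (if (u, j) \<in> mat_rel X ^^ Suc n then {[(u, t - int (Suc n)), (j, t)]} else {}) \<union>
    (\<Union>(q, w)\<in>(SIGMA q:{1..<Suc n}. {w. (u, w) \<in> mat_rel X ^^ q}).
       (#) (u, t - int (Suc n)) ` chains_between (level_poset X) (w, t - int (Suc n - q)) (j, t))"
    (is "?L = ?C \<union> ?R")
proof -
  let ?Q = "level_poset X"
  let ?x = "(u, t - int (Suc n))"
  have "nat (t - (t - int (Suc n))) = Suc n" by simp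
  then have "(?x, (j, t)) \<in> ?Q \<and> ?x \<noteq> (j, t) \<longleftrightarrow> (u, j) \<in> mat_rel X ^^ Suc n"
    using u by (simp add: level_poset_iff del: relpow.simps)
  moreover have "(\<Union>z\<in>{z. (?x, z) \<in> ?Q \<and> ?x \<noteq> z}. (#) ?x ` chains_between ?Q z (j, t)) = ?R"
  proof (intro equalityI subsetI)
    fix xs assume "xs \<in> (\<Union>z\<in>{z. (?x, z) \<in> ?Q \<and> ?x \<noteq> z}. (#) ?x ` chains_between ?Q z (j, t))"
    then obtain w s zs where z: "(?x, (w, s)) \<in> ?Q" "?x \<noteq> (w, s)" and
      zs: "zs \<in> chains_between ?Q (w, s) (j, t)" "xs = ?x # zs"
      by auto
    define q where "q = nat (s - (t - int (Suc n)))"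
    \<comment> \<open>The remaining chain must still climb, which bounds \<open>q\<close> strictly
      by the full length.\<close>
    have "s < t" using chains_between_imp_less[OF zs(1)] level_poset_less[of w s j t X] by auto
    then have q: "q \<in> {1..<Suc n}" and s: "s = t - int (Suc n - q)"
      using level_poset_less[OF z(1)] z(2) by (auto simp: q_def)
    have "(u, w) \<in> mat_rel X ^^ q" using z(1) by (simp add: level_poset_iff q_def)
    then show "xs \<in> ?R" using q zs unfolding s by blast
  next
    fix xs assume "xs \<in> ?R"
    then obtain q w zs where q: "q \<in> {1..<Suc n}" "(u, w) \<in> mat_rel X ^^ q" and
      zs: "zs \<in> chains_between ?Q (w, t - int (Suc n - q)) (j, t)" "xs = ?x # zs"
      by blast
    have "nat ((t - int (Suc n - q)) - (t - int (Suc n))) = q" using q(1) by auto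
    moreover have "w < dim_row X" using mat_rel_relpow_less[OF X q(2)] q(1) by simp
    ultimately have "(?x, (w, t - int (Suc n - q))) \<in> ?Q" using u q by (simp add: level_poset_iff)
    moreover have "?x \<noteq> (w, t - int (Suc n - q))" using q(1) by auto
    ultimately show "xs \<in> (\<Union>z\<in>{z. (?x, z) \<in> ?Q \<and> ?x \<noteq> z}. (#) ?x ` chains_between ?Q z (j, t))"
      using zs by blast
  qed
  ultimately show ?thesis
    by (subst chains_between_rec[OF Partial_order_level_poset]) simp
qed

text \<open>Induction on the height: there are finitely many second elements, each at a smaller
  height below the top.\<close>

lemma finite_chains_level:
  assumes X: "square_mat X" and j: "j < dim_row X"
  shows "u < dim_row X \<Longrightarrow> finite (chains_between (level_poset X) (u, t - int n) (j, t))"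
proof (induction n arbitrary: u rule: less_induct)
  case (less n)
  show ?case
  proof (cases n)
    case 0
    have "xs \<notin> chains_between (level_poset X) (u, t) (j, t)" for xs
      using chains_between_imp_less[of xs "level_poset X" "(u, t)" "(j, t)"]
        level_poset_less[of u t j t X] by auto
    then have "chains_between (level_poset X) (u, t) (j, t) = {}" by blast
    then show ?thesis using 0 by simp
  next
    case (Suc m)
    have "finite (SIGMA q:{1..<Suc m}. {w. (u, w) \<in> mat_rel X ^^ q})"
      using finite_relpow_between[OF X, of u _ "\<lambda>_. True"] by auto
    moreover have "finite (chains_between (level_poset X) (w, t - int (Suc m - q)) (j, t))"
      if "q \<in> {1..<Suc m}" "(u, w) \<in> mat_rel X ^^ q" for q w
      using that Suc mat_rel_relpow_less[OF X that(2)] by (intro less.IH) auto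
    ultimately show ?thesis
      unfolding Suc chains_level_rec[OF X less.prems j] by auto
  qed
qed

lemma chain_sum_0: "chain_sum X j K 0 u = 0"
proof -
  have "xs \<notin> chains_between (level_poset X) (u, int K) (j, int K)" for xs
    using chains_between_imp_less[of xs "level_poset X" "(u, int K)" "(j, int K)"]
      level_poset_less[of u "int K" j "int K" X] by auto
  then have "chains_between (level_poset X) (u, int K) (j, int K) = {}" by blast
  then show ?thesis by (simp add: chain_sum_def)
qed

text \<open>The factor contributed by the first step of a chain depends only on the height
  \<open>q\<close> of its second element. This supplies the recursion assumed in
  \<open>chain_recursion_solution\<close>.\<close>

lemma chain_sum_rec:
  assumes X: "square_mat X" and u: "u < dim_row X" "j < dim_row X" and n: "1 \<le> n" "n \<le> K"
  shows "chain_sum X j K n u = of_bool ((u, j) \<in> mat_rel X ^^ n) * (ab_a - ab_b) ^ (n - 1) +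
    (\<Sum>q\<in>{1..<n}. \<Sum>w\<in>{w. (u, w) \<in> mat_rel X ^^ q}.
      (ab_a - ab_b) ^ (q - 1) * ab_b * chain_sum X j K (n - q) w)"
proof -
  obtain m where m: "n = Suc m" using n(1) by (cases n) auto
  let ?Q = "level_poset X"
  let ?x = "(u, int K - int n)"
  let ?S = "SIGMA q:{1..<n}. {w. (u, w) \<in> mat_rel X ^^ q}"
  let ?ch = "\<lambda>(q, w). (#) ?x ` chains_between ?Q (w, int K - int (n - q)) (j, int K)"
  let ?C = "if (u, j) \<in> mat_rel X ^^ n then {[?x, (j, int K)]} else {}"
  let ?wt = "chain_weight level_rank"
  have eq: "chains_between ?Q ?x (j, int K) = ?C \<union> (\<Union>qw\<in>?S. ?ch qw)"
    unfolding m by (subst chains_level_rec[OF X u]) auto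
  have finS: "finite ?S"
    using finite_relpow_between[OF X, of u _ "\<lambda>_. True"] by auto
  have less: "w < dim_row X" if "q \<in> {1..<n}" "(u, w) \<in> mat_rel X ^^ q" for q w
    using mat_rel_relpow_less[OF X that(2)] that(1) by simp
  have fin: "finite (?ch qw)" if "qw \<in> ?S" for qw
  proof -
    obtain q w where qw: "qw = (q, w)" "q \<in> {1..<n}" "(u, w) \<in> mat_rel X ^^ q"
      using \<open>qw \<in> ?S\<close> by auto
    show ?thesis
      unfolding qw(1) prod.case by (intro finite_imageI finite_chains_level[OF X u(2) less[OF qw(2,3)]])
  qed
  have len: "length zs \<ge> 2 \<and> hd zs = z" if "zs \<in> chains_between ?Q z y" for zs z y
    using that by (simp add: chains_between_def)
  have disj: "?ch qw \<inter> ?ch qw' = {}" if "qw \<in> ?S" "qw' \<in> ?S" "qw \<noteq> qw'" for qw qw'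
  proof -
    obtain q w q' w' where qw: "qw = (q, w)" "qw' = (q', w')" by (cases qw, cases qw')
    have "(w, int K - int (n - q)) \<noteq> (w', int K - int (n - q'))"
      using that unfolding qw by auto
    then have "chains_between ?Q (w, int K - int (n - q)) (j, int K) \<inter>
        chains_between ?Q (w', int K - int (n - q')) (j, int K) = {}"
      by (rule chains_between_disjoint)
    then show ?thesis unfolding qw prod.case by blast
  qed
  have "?C \<inter> (\<Union>qw\<in>?S. ?ch qw) = {}"
  proof -
    have "[(j, int K)] \<notin> chains_between ?Q z y" for z y
      by (simp add: chains_between_def)
    then show ?thesis by auto
  qed
  then have "chain_sum X j K n u = sum ?wt ?C + sum ?wt (\<Union>qw\<in>?S. ?ch qw)"
    unfolding chain_sum_def eq using finS fin by (intro sum.union_disjoint) auto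
  also have "sum ?wt ?C = of_bool ((u, j) \<in> mat_rel X ^^ n) * (ab_a - ab_b) ^ (n - 1)"
    using n by (simp add: level_rank_def nat_diff_distrib)
  also have "sum ?wt (\<Union>qw\<in>?S. ?ch qw) = (\<Sum>qw\<in>?S. sum ?wt (?ch qw))"
    using finS fin disj by (intro sum.UNION_disjoint) blast+
  also have "\<dots> = (\<Sum>(q, w)\<in>?S.
      (ab_a - ab_b) ^ (q - 1) * ab_b * chain_sum X j K (n - q) w)"
  proof (intro sum.cong refl, clarify)
    fix q w assume q: "q \<in> {1..<n}" and w: "(u, w) \<in> mat_rel X ^^ q"
    have "?wt (?x # zs) = (ab_a - ab_b) ^ (q - 1) * ab_b * ?wt zs"
      if zs: "zs \<in> chains_between ?Q (w, int K - int (n - q)) (j, int K)" for zs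
    proof -
      \<comment> \<open>Two elements of \<open>zs\<close> must be visible for the last equation of
        \<open>chain_weight\<close> to apply.\<close>
      obtain z2 zs' where zs': "zs = (w, int K - int (n - q)) # z2 # zs'"
        using len[OF zs] by (cases zs; cases "tl zs") auto
      \<comment> \<open>Here \<open>n \<le> K\<close> keeps \<open>nat\<close> from
        truncating.\<close>
      have "level_rank (w, int K - int (n - q)) - level_rank ?x = q"
        using q n(2) by (simp add: level_rank_def nat_diff_distrib)
      then show ?thesis unfolding zs' by simp
    qed
    then show "sum ?wt ((#) ?x ` chains_between ?Q (w, int K - int (n - q)) (j, int K)) =
        (ab_a - ab_b) ^ (q - 1) * ab_b * chain_sum X j K (n - q) w"
      by (subst sum.reindex) (simp_all add: chain_sum_def sum_distrib_left)
  qed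
  also have "\<dots> = (\<Sum>q\<in>{1..<n}. \<Sum>w\<in>{w. (u, w) \<in> mat_rel X ^^ q}.
      (ab_a - ab_b) ^ (q - 1) * ab_b * chain_sum X j K (n - q) w)"
    by (subst sum.Sigma) (use finite_relpow_between[OF X, of u _ "\<lambda>_. True"] in auto)
  finally show ?thesis .
qed

theorem corollary5p5:
  fixes r k i j :: nat
  assumes "r \<ge> 2" and "i \<in> {r + 1..2 * r + 1}" and "j \<in> {0..r}"
  shows "has_cd_index
           (poset_interval (level_poset (matrix_N r)) (i, 0) (j, int k + 1))
           (\<Sum>w\<in>{w. cd_degree w = k}. Poly_Mapping.single w (int r ^ num_d w))"
proof -
  have X: "square_mat (matrix_N r)" by simp
  have lt: "i < 2 * r + 2" "j < 2 * r + 2" using assms by auto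
  have "(i, j) \<in> N_rel r ^^ Suc k"
  proof -
    consider "k = 0" | "k = 1" | "Suc k \<ge> 3"
      by linarith
    then show ?thesis
    proof cases
      case 1 then show ?thesis using assms by (simp add: N_rel_iff succs_def)
    next
      case 2 then show ?thesis using assms N_rel_relpow_2[of r i j] by (simp add: succs2_def numeral_2_eq_2)
    next
      case 3 then show ?thesis using lt N_rel_relpow_ge_3[OF assms(1), of i j "Suc k - 3"] by simp
    qed
  qed
  moreover have "nat (int k + 1 - 0) = Suc k" by simp
  ultimately have le: "((i, 0), (j, int k + 1)) \<in> level_poset (matrix_N r)"
    using lt by (simp only: level_poset_iff dim_matrix_N) simp
  let ?P = "poset_interval (level_poset (matrix_N r)) (i, 0) (j, int k + 1)"
  have "eulerian_poset ?P level_rank"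
    using alternating_walk_count[OF assms(1)] by (intro eulerian_level_interval[OF X le]) simp
  moreover have "ab_index ?P level_rank = chain_sum (matrix_N r) j (Suc k) (Suc k) i"
    unfolding ab_index_def bounded_chains_poset_interval[OF Partial_order_level_poset le] chain_sum_def
    by (simp add: add.commute)
  \<comment> \<open>With the top at level \<open>Suc k\<close>, the recursion holds for all lengths
    up to \<open>M = Suc k\<close>, the length of the whole interval.\<close>
  moreover have "\<dots> = cd_rec (ab_a + ab_b) (ab_a * ab_b + ab_b * ab_a) r (Suc k)"
    using assms lt chain_sum_0 chain_sum_rec[OF X, of _ j _ "Suc k"]
    by (intro chain_recursion_solution[where M = "Suc k" and j = j]) auto
  ultimately show ?thesis
    unfolding has_cd_index_def cd_to_ab_sum by metis
qed

end
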